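(* Let $\mathbf{x}^\star\in\mathbb{R}^K$ be a deterministic (sparse) vector, and let $\{\mathbf{x}^{(t)}\}_{t\ge 1}$ be the sequence of estimates generated by the Online Parallel Algorithm (described in the context) from the sequentially available samples $\{\mathbf{g}_n^{(\tau)},y_n^{(\tau)}\}_{n=1}^N$, $\tau=1,2,\ldots$, of the linear model $y_n=\mathbf{g}_n^T\mathbf{x}^\star+v_n$, $n=1,\ldots,N$, with regularization gains $\mu^{(t)}$ and proximal weights $c_k^{(t)}>0$. Suppose that: (A1) $\mathbf{g}_n$, $n=1,\ldots,N$, are independently and identically distributed random vectors in $\mathbb{R}^K$ with a bounded positive definite covariance matrix; (A2) $v_n$, $n=1,\ldots,N$, are i.i.d. real random variables with zero mean and bounded variance, and are uncorrelated with $\mathbf{g}_n$; (A3) $\mu^{(t)}>0$ for all $t$ and $\lim_{t\to\infty}\mu^{(t)}=0$; (A4) both $\mathbf{g}_n$ and $v_n$ have bounded moments; (A5) there is a constant $c>0$ such that $G_{kk}^{(t)}+c_k^{(t)}\ge c$ for all $k=1,\ldots,K$ and all $t$; (A6) the sequence $\{\mu^{(t)}\}$ is nonincreasing, i.e., $\mu^{(t)}\ge\mu^{(t+1)}$ for all $t$. Then $\mathbf{x}^{(t)}$ is a strongly consistent estimator of $\mathbf{x}^\star$, i.e., $\lim_{t\to\infty}\mathbf{x}^{(t)}=\mathbf{x}^\star$ with probability 1.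
   Context: Samples. Fix positive integers $K,N$. For each time $\tau=1,2,\ldots$ one observes $(\mathbf{g}_n^{(\tau)},y_n^{(\tau)})\in\mathbb{R}^K\times\mathbb{R}$, $n=1,\ldots,N$, with $y_n^{(\tau)}=(\mathbf{g}_n^{(\tau)})^T\mathbf{x}^\star+v_n^{(\tau)}$, where the families $(\mathbf{g}_n^{(\tau)},v_n^{(\tau)})_{n=1}^N$, $\tau=1,2,\ldots$, are independent copies of $(\mathbf{g}_n,v_n)_{n=1}^N$. "Bounded moments" means that all moments are finite. Sample averages and loss. $$\mathbf{G}^{(t)}=\frac1t\sum_{\tau=1}^t\sum_{n=1}^N\mathbf{g}_n^{(\tau)}(\mathbf{g}_n^{(\tau)})^T,\qquad \mathbf{b}^{(t)}=\frac1t\sum_{\tau=1}^t\sum_{n=1}^N y_n^{(\tau)}\mathbf{g}_n^{(\tau)},$$ $$L^{(t)}(\mathbf{x})=\tfrac12\mathbf{x}^T\mathbf{G}^{(t)}\mathbf{x}-(\mathbf{b}^{(t)})^T\mathbf{x}+\mu^{(t)}\|\mathbf{x}\|_1 .$$ $G_{kj}^{(t)}$ denotes the $(k,j)$ entry of $\mathbf{G}^{(t)}$ and $b_k^{(t)}$ the $k$-th entry of $\mathbf{b}^{(t)}$. Online Parallel Algorithm. Initialize $\mathbf{x}^{(1)}=\mathbf{0}$. At each time $t=1,2,\ldots$: Step 1. Compute $\hat{\mathbf{x}}^{(t)}=(\hat x_k^{(t)})_{k=1}^K$, where $$\hat x_k^{(t)}=\underset{x_k\in\mathbb{R}}{\arg\min}\Bigl\{L^{(t)}(x_k,\mathbf{x}_{-k}^{(t)})+\tfrac12c_k^{(t)}(x_k-x_k^{(t)})^2\Bigr\}=\frac{\mathcal{S}_{\mu^{(t)}}(r_k^{(t)}+c_k^{(t)}x_k^{(t)})}{G_{kk}^{(t)}+c_k^{(t)}},$$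 with $r_k^{(t)}=b_k^{(t)}-\sum_{j\ne k}G_{kj}^{(t)}x_j^{(t)}$ and $\mathcal{S}_a(b)=\max(b-a,0)-\max(-b-a,0)$; here $(x_k,\mathbf{x}_{-k}^{(t)})$ is the vector $\mathbf{x}^{(t)}$ with its $k$-th entry replaced by $x_k$. Step 2. Compute the stepsize $$\gamma^{(t)}=\underset{0\le\gamma\le1}{\arg\min}\Bigl\{\tfrac12\mathbf{d}^T\mathbf{G}^{(t)}\mathbf{d}\,\gamma^2+\bigl[(\mathbf{G}^{(t)}\mathbf{x}^{(t)}-\mathbf{b}^{(t)})^T\mathbf{d}+\mu^{(t)}(\|\hat{\mathbf{x}}^{(t)}\|_1-\|\mathbf{x}^{(t)}\|_1)\bigr]\gamma\Bigr\},\quad \mathbf{d}=\hat{\mathbf{x}}^{(t)}-\mathbf{x}^{(t)}.$$ When $\mathbf{d}^T\mathbf{G}^{(t)}\mathbf{d}>0$ this equals the projection onto $[0,1]$ of $-\dfrac{(\mathbf{G}^{(t)}\mathbf{x}^{(t)}-\mathbf{b}^{(t)})^T\mathbf{d}+\mu^{(t)}(\|\hat{\mathbf{x}}^{(t)}\|_1-\|\mathbf{x}^{(t)}\|_1)}{\mathbf{d}^T\mathbf{G}^{(t)}\mathbf{d}}$. If $\mathbf{d}=\mathbf{0}$, set $\gamma^{(t)}=0$ (the choice is immaterial). Step 3. Put $\tilde{\mathbf{x}}^{(t)}=\mathbf{x}^{(t)}+\gamma^{(t)}(\hat{\mathbf{x}}^{(t)}-\mathbf{x}^{(t)})$ and set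 $\mathbf{x}^{(t+1)}=\tilde{\mathbf{x}}^{(t)}$ if $L^{(t)}(\tilde{\mathbf{x}}^{(t)})\le 0$, and $\mathbf{x}^{(t+1)}=\mathbf{0}$ otherwise.
   Formalization: The proximal weights c_k^(t) are additionally assumed to be bounded above almost surely, uniformly in t and k (the bound may be random); without this the claim fails, e.g. K=N=1, x*=1, g=±1, v=0, μ^(t)=0.1/t, c^(t)=2^(t+2). *)

theory Defs
  imports "HOL-Probability.Probability"
begin

section \<open>Probabilistic notions\<close>

definition iid :: "'a measure \<Rightarrow> ('i \<Rightarrow> 'a \<Rightarrow> 'b::topological_space) \<Rightarrow> 'i set \<Rightarrow> bool" where
  "iid M X I \<longleftrightarrow>
     prob_space.indep_vars M (\<lambda>_. borel) X I \<and>
     (\<forall>i\<in>I. \<forall>j\<in>I. distr M borel (X i) = distr M borel (X j))"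

definition covariance :: "'a measure \<Rightarrow> ('a \<Rightarrow> real) \<Rightarrow> ('a \<Rightarrow> real) \<Rightarrow> real" where
  "covariance M X Y =
     (LINT \<omega>|M. (X \<omega> - (LINT \<omega>'|M. X \<omega>')) * (Y \<omega> - (LINT \<omega>'|M. Y \<omega>')))"

definition covariance_matrix :: "'a measure \<Rightarrow> ('a \<Rightarrow> real^'k) \<Rightarrow> real^'k^'k" where
  "covariance_matrix M X = (\<chi> i j. covariance M (\<lambda>\<omega>. X \<omega> $ i) (\<lambda>\<omega>. X \<omega> $ j))"

definition positive_definite :: "real^'k^'k \<Rightarrow> bool" where
  "positive_definite A \<longleftrightarrow> transpose A = A \<and> (\<forall>x. x \<noteq> 0 \<longrightarrow> x \<bullet> (A *v x) > 0)"

definition finite_moments :: "'a measure \<Rightarrow> ('a \<Rightarrow> 'b::real_normed_vector) \<Rightarrow> bool" where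
  "finite_moments M X \<longleftrightarrow> (\<forall>p::nat. integrable M (\<lambda>\<omega>. norm (X \<omega>) ^ p))"

section \<open>Sample averages and loss\<close>

text \<open>The definitions below refer to one realization of the samples:
  \<^term>\<open>g \<tau> n\<close> and \<^term>\<open>y \<tau> n\<close> are the regressor and the observation with
  index \<^term>\<open>n\<close> at time \<^term>\<open>\<tau>\<close>. Time starts at 1.\<close>

definition outer :: "real^'k \<Rightarrow> real^'k^'k" where
  "outer a = (\<chi> i j. a $ i * a $ j)"

definition Gmat :: "(nat \<Rightarrow> 'n::finite \<Rightarrow> real^'k) \<Rightarrow> nat \<Rightarrow> real^'k^'k" where
  "Gmat g t = (1 / real t) *\<^sub>R (\<Sum>\<tau>=1..t. \<Sum>n\<in>UNIV. outer (g \<tau> n))"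

definition bvec :: "(nat \<Rightarrow> 'n::finite \<Rightarrow> real^'k) \<Rightarrow> (nat \<Rightarrow> 'n \<Rightarrow> real) \<Rightarrow> nat \<Rightarrow> real^'k" where
  "bvec g y t = (1 / real t) *\<^sub>R (\<Sum>\<tau>=1..t. \<Sum>n\<in>UNIV. y \<tau> n *\<^sub>R g \<tau> n)"

definition l1_norm :: "real^'k::finite \<Rightarrow> real" where
  "l1_norm x = (\<Sum>k\<in>UNIV. \<bar>x $ k\<bar>)"

definition loss :: "real^'k^'k \<Rightarrow> real^'k \<Rightarrow> real \<Rightarrow> real^'k::finite \<Rightarrow> real" where
  "loss G b \<mu> x = 1/2 * (x \<bullet> (G *v x)) - b \<bullet> x + \<mu> * l1_norm x"

section \<open>Online parallel algorithm\<close>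

definition replace_entry :: "real^'k \<Rightarrow> 'k \<Rightarrow> real \<Rightarrow> real^'k" where
  "replace_entry x k z = (\<chi> j. if j = k then z else x $ j)"

definition best_response ::
    "real^'k^'k \<Rightarrow> real^'k \<Rightarrow> real \<Rightarrow> real^'k \<Rightarrow> real^'k \<Rightarrow> real^'k::finite" where
  "best_response G b \<mu> c x =
     (\<chi> k. ARG_MIN (\<lambda>z. loss G b \<mu> (replace_entry x k z) + 1/2 * c $ k * (z - x $ k)\<^sup>2) z. True)"

definition stepsize ::
    "real^'k^'k \<Rightarrow> real^'k \<Rightarrow> real \<Rightarrow> real^'k \<Rightarrow> real^'k::finite \<Rightarrow> real" where
  "stepsize G b \<mu> x xh =
     (let d = xh - x in
      if d = 0 then 0
      else arg_min_on
             (\<lambda>\<gamma>. 1/2 * (d \<bullet> (G *v d)) * \<gamma>\<^sup>2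
                  + ((G *v x - b) \<bullet> d + \<mu> * (l1_norm xh - l1_norm x)) * \<gamma>)
             {0..1})"

definition opa_step ::
    "real^'k^'k \<Rightarrow> real^'k \<Rightarrow> real \<Rightarrow> real^'k \<Rightarrow> real^'k \<Rightarrow> real^'k::finite" where
  "opa_step G b \<mu> c x =
     (let xh = best_response G b \<mu> c x;
          xt = x + stepsize G b \<mu> x xh *\<^sub>R (xh - x)
      in if loss G b \<mu> xt \<le> 0 then xt else 0)"

text \<open>The value at time 0 is a dummy; the sequence of estimates starts at time 1.\<close>

primrec opa ::
    "(nat \<Rightarrow> 'n::finite \<Rightarrow> real^'k) \<Rightarrow> (nat \<Rightarrow> 'n \<Rightarrow> real) \<Rightarrow> (nat \<Rightarrow> real) \<Rightarrow> (nat \<Rightarrow> real^'k)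
      \<Rightarrow> nat \<Rightarrow> real^'k::finite" where
  "opa g y \<mu> c 0 = 0"
| "opa g y \<mu> c (Suc t) =
     (if t = 0 then 0 else opa_step (Gmat g t) (bvec g y t) (\<mu> t) (c t) (opa g y \<mu> c t))"

end

theory Submission
  imports Defs
begin

text \<open>Let \<open>G\<^sub>s = \<Sum>\<^sub>n E (g\<^sub>n g\<^sub>n\<^sup>T)\<close>, which is positive definite. By the strong law of large numbers
  (all moments are finite, so fourth moments and summability suffice), \<open>G\<^sup>t \<rightarrow> G\<^sub>s\<close> and
  \<open>b\<^sup>t \<rightarrow> G\<^sub>s x\<^sup>*\<close> almost surely; from here on the argument is deterministic.

  The test \<open>L\<^sup>t(x) \<le> 0\<close> keeps the iterates bounded. On bounded sets \<open>2 L\<^sup>t\<close> is, up to a constant and an error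
  tending to 0, the function \<open>V(x) = (x - x\<^sup>*) \<bullet> G\<^sub>s (x - x\<^sup>*)\<close>. With \<open>p\<close> the gradient of the quadratic part of
  \<open>L\<^sup>t\<close>, one step decreases \<open>L\<^sup>t\<close> by a multiple of \<open>\<bar>p\<bar>\<^sup>2\<close> up to a term of order \<open>\<mu>\<^sup>t\<close>, and \<open>\<bar>p\<bar>\<^sup>2\<close> dominates a
  multiple of \<open>V\<close>. Hence \<open>V(x\<^sup>t\<^sup>+\<^sup>1) \<le> q V(x\<^sup>t) + \<epsilon>\<^sup>t\<close> with \<open>q < 1\<close> and \<open>\<epsilon>\<^sup>t \<rightarrow> 0\<close>, which forces \<open>V(x\<^sup>t) \<rightarrow> 0\<close>.\<close>

section \<open>One step of the algorithm\<close>

text \<open>\<open>arg_min\<close> is a choice operator, so a minimiser must be shown to exist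
  before anything can be said about the best response. The function is continuous and coercive, so
  its minimum over a compact interval around \<open>x\<close> is global.\<close>

lemma is_arg_min_soft_threshold:
  fixes A p m x :: real
  assumes "A > 0"
  obtains z0 where "is_arg_min (\<lambda>z. A/2 * (z - x)\<^sup>2 + p * (z - x) + m * \<bar>z\<bar>) (\<lambda>_. True) z0"
proof -
  define h where "h z = A/2 * (z - x)\<^sup>2 + p * (z - x) + m * \<bar>z\<bar>" for z
  \<comment> \<open>At distance \<open>R\<close> from \<open>x\<close> the quadratic term equals
    (\<bar>p\<bar> + \<bar>m\<bar>) \<bar>z - x\<bar>, which bounds the change of the two other
    terms. Points farther away are no better than \<open>x\<close>, which lies in the
    interval.\<close>
  define R where "R = 2 * (\<bar>p\<bar> + \<bar>m\<bar>) / A"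
  have cont: "continuous_on {x - R..x + R} h"
    unfolding h_def by (intro continuous_intros)
  have "R \<ge> 0" using assms by (simp add: R_def)
  then obtain z0 where z0: "z0 \<in> {x - R..x + R}" "\<And>z. z \<in> {x - R..x + R} \<Longrightarrow> h z0 \<le> h z"
    using continuous_attains_inf[OF compact_Icc _ cont] by (metis atLeastAtMost_iff diff_le_eq empty_iff le_add_same_cancel1)
  have "h z0 \<le> h z" for z
  proof (cases "z \<in> {x - R..x + R}")
    case True then show ?thesis using z0 by simp
  next
    case False
    then have far: "\<bar>z - x\<bar> > R" by (auto simp: abs_real_def)
    have "A * \<bar>z - x\<bar> \<ge> 2 * (\<bar>p\<bar> + \<bar>m\<bar>)"
      using far assms by (simp add: R_def field_simps)
    then have "A / 2 * \<bar>z - x\<bar> * \<bar>z - x\<bar> \<ge> (\<bar>p\<bar> + \<bar>m\<bar>) * \<bar>z - x\<bar>"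
      by (intro mult_right_mono) auto
    moreover have "A/2 * (z - x)\<^sup>2 = A / 2 * \<bar>z - x\<bar> * \<bar>z - x\<bar>"
      by (simp add: power2_eq_square abs_mult[symmetric] )
    moreover have "p * (z - x) \<ge> - (\<bar>p\<bar> * \<bar>z - x\<bar>)"
      by (metis abs_ge_minus_self abs_mult minus_le_iff)
    moreover have "m * \<bar>z\<bar> - m * \<bar>x\<bar> \<ge> - (\<bar>m\<bar> * \<bar>z - x\<bar>)"
    proof -
      have "\<bar>m * (\<bar>z\<bar> - \<bar>x\<bar>)\<bar> \<le> \<bar>m\<bar> * \<bar>z - x\<bar>"
        unfolding abs_mult by (intro mult_left_mono) auto
      then show ?thesis by (simp add: algebra_simps abs_le_iff)
    qed
    ultimately have "h x \<le> h z" by (simp add: h_def algebra_simps)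
    with z0(2)[of x] \<open>R \<ge> 0\<close> show ?thesis by simp
  qed
  then have "is_arg_min h (\<lambda>_. True) z0" by (auto simp: is_arg_min_linorder)
  then show ?thesis using that unfolding h_def[abs_def] by blast
qed

section \<open>Change of the loss along a coordinate and along a line\<close>

lemma replace_entry_axis: "replace_entry x k z = x + (z - x $ k) *\<^sub>R axis k 1"
  by (simp add: vec_eq_iff replace_entry_def axis_def)

lemma symmetric_dot_matrix_vector:
  fixes G :: "real^'k^'k::finite"
  assumes "transpose G = G"
  shows "x \<bullet> (G *v y) = y \<bullet> (G *v x)"
  by (metis assms dot_lmul_matrix inner_commute transpose_matrix_vector)

lemma l1_norm_replace_entry:
  "l1_norm (replace_entry x k z) = l1_norm x + (\<bar>z\<bar> - \<bar>x $ k\<bar>)"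
proof -
  have "(\<Sum>j\<in>UNIV - {k}. \<bar>replace_entry x k z $ j\<bar>) = (\<Sum>j\<in>UNIV - {k}. \<bar>x $ j\<bar>)"
    by (rule sum.cong) (auto simp: replace_entry_def)
  moreover have "replace_entry x k z $ k = z" by (simp add: replace_entry_def)
  ultimately show ?thesis
    using sum.remove[of UNIV k "\<lambda>j. \<bar>replace_entry x k z $ j\<bar>"] sum.remove[of UNIV k "\<lambda>j. \<bar>x $ j\<bar>"]
    unfolding l1_norm_def by simp
qed

text \<open>Symmetry of \<open>G\<close> merges the two cross terms. The expansion serves twice:
  with \<open>d\<close> a coordinate axis for the best response, and with \<open>d\<close> the
  search direction for the line search.\<close>

lemma quadratic_shift:
  fixes G :: "real^'k^'k::finite"
  assumes "transpose G = G"
  shows "1/2 * ((x + \<gamma> *\<^sub>R d) \<bullet> (G *v (x + \<gamma> *\<^sub>R d))) - b \<bullet> (x + \<gamma> *\<^sub>R d) =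
    1/2 * (x \<bullet> (G *v x)) - b \<bullet> x + 1/2 * (d \<bullet> (G *v d)) * \<gamma>\<^sup>2 + ((G *v x - b) \<bullet> d) * \<gamma>"
  using symmetric_dot_matrix_vector[OF assms, of x d]
  by (simp add: matrix_vector_right_distrib matrix_vector_mult_scaleR inner_add_left inner_add_right
      inner_diff_left inner_commute[of "G *v x" d] power2_eq_square algebra_simps)

lemma loss_replace_entry:
  assumes "transpose G = G"
  shows "loss G b \<mu> (replace_entry x k z) =
    loss G b \<mu> x + G $ k $ k / 2 * (z - x $ k)\<^sup>2 + (G *v x - b) $ k * (z - x $ k) + \<mu> * (\<bar>z\<bar> - \<bar>x $ k\<bar>)"
proof -
  have 1: "axis k 1 \<bullet> (G *v axis k 1) = G $ k $ k"
    by (simp add: inner_axis' matrix_vector_mult_basis column_def)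
  have 2: "(G *v x - b) \<bullet> axis k 1 = (G *v x - b) $ k"
    by (simp add: inner_axis)
  show ?thesis
    unfolding loss_def l1_norm_replace_entry
    unfolding replace_entry_axis quadratic_shift[OF assms] 1 2
    by (simp add: algebra_simps)
qed

text \<open>As a function of \<open>z\<close>, the objective of coordinate \<open>k\<close> differs
  from the scalar function of \<open>is_arg_min_soft_threshold\<close> only by a constant, so both
  have the same minimisers.\<close>

lemma best_response_le:
  fixes G :: "real^'k^'k::finite" and b x c :: "real^'k"
  assumes "transpose G = G" and A: "G $ k $ k + c $ k > 0"
  defines "A \<equiv> G $ k $ k + c $ k" and "p \<equiv> (G *v x - b) $ k"
  shows "A/2 * (best_response G b \<mu> c x $ k - x $ k)\<^sup>2 + p * (best_response G b \<mu> c x $ k - x $ k)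
      + \<mu> * \<bar>best_response G b \<mu> c x $ k\<bar>
    \<le> A/2 * (z - x $ k)\<^sup>2 + p * (z - x $ k) + \<mu> * \<bar>z\<bar>"
proof -
  define h where "h z = A/2 * (z - x $ k)\<^sup>2 + p * (z - x $ k) + \<mu> * \<bar>z\<bar>" for z
  define f where "f z = loss G b \<mu> (replace_entry x k z) + 1/2 * c $ k * (z - x $ k)\<^sup>2" for z
  have fh: "f z = h z + (loss G b \<mu> x - \<mu> * \<bar>x $ k\<bar>)" for z
    unfolding f_def h_def loss_replace_entry[OF assms(1)] A_def p_def by (simp add: algebra_simps)
  obtain z0 where "is_arg_min h (\<lambda>_. True) z0"
    using is_arg_min_soft_threshold[of A "x $ k" p \<mu>] A unfolding A_def h_def[abs_def] by metis
  then have "is_arg_min f (\<lambda>_. True) z0" by (auto simp: is_arg_min_linorder fh)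
  then have "is_arg_min f (\<lambda>_. True) (arg_min f (\<lambda>_. True))"
    unfolding arg_min_def by (rule someI)
  then have "h (arg_min f (\<lambda>_. True)) \<le> h z" by (simp add: is_arg_min_linorder fh)
  moreover have "best_response G b \<mu> c x $ k = arg_min f (\<lambda>_. True)"
    by (simp add: best_response_def f_def[abs_def])
  ultimately show ?thesis by (simp add: h_def)
qed

lemma stepsize_le:
  fixes G :: "real^'k^'k::finite" and b x :: "real^'k" and \<mu> \<gamma> :: real
  assumes "\<gamma> \<in> {0..1}"
  defines "\<phi> \<equiv> \<lambda>xh \<gamma>. 1/2 * ((xh - x) \<bullet> (G *v (xh - x))) * \<gamma>\<^sup>2
     + ((G *v x - b) \<bullet> (xh - x) + \<mu> * (l1_norm xh - l1_norm x)) * \<gamma>"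
  shows "\<phi> xh (stepsize G b \<mu> x xh) \<le> \<phi> xh \<gamma>" and "stepsize G b \<mu> x xh \<in> {0..1}"
proof -
  have "\<phi> xh (stepsize G b \<mu> x xh) \<le> \<phi> xh \<gamma> \<and> stepsize G b \<mu> x xh \<in> {0..1}"
  proof (cases "xh - x = 0")
    \<comment> \<open>Here \<open>\<phi> xh\<close> vanishes identically, so the default value 0 of
      \<open>stepsize\<close> is minimal too.\<close>
    case True
    then show ?thesis by (simp add: \<phi>_def stepsize_def)
  next
    case False
    have "continuous_on {0..1} (\<phi> xh)" unfolding \<phi>_def by (intro continuous_intros)
    then obtain z0 where "z0 \<in> {0..1}" "\<And>z. z \<in> {0..1} \<Longrightarrow> \<phi> xh z0 \<le> \<phi> xh z"
      using continuous_attains_inf[of "{0..1::real}" "\<phi> xh"] by fastforce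
    then have "is_arg_min (\<phi> xh) (\<lambda>z. z \<in> {0..1}) z0" by (auto simp: is_arg_min_linorder)
    then have "is_arg_min (\<phi> xh) (\<lambda>z. z \<in> {0..1}) (arg_min_on (\<phi> xh) {0..1})"
      unfolding arg_min_on_def arg_min_def by (rule someI)
    moreover have "stepsize G b \<mu> x xh = arg_min_on (\<phi> xh) {0..1}"
      using False by (simp add: stepsize_def \<phi>_def Let_def)
    ultimately show ?thesis using assms(1) by (auto simp: is_arg_min_linorder)
  qed
  then show "\<phi> xh (stepsize G b \<mu> x xh) \<le> \<phi> xh \<gamma>" "stepsize G b \<mu> x xh \<in> {0..1}" by auto
qed

section \<open>The l1 norm along a segment and the sign of the loss\<close>

lemma l1_norm_nonneg: "l1_norm x \<ge> 0"
  by (simp add: l1_norm_def sum_nonneg)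

lemma l1_norm_0 [simp]: "l1_norm 0 = 0"
  by (simp add: l1_norm_def)

text \<open>The right-hand side is the chord, linear in \<open>\<gamma>\<close>. Replacing the l1
  norm by its chord turns the change of the loss along the segment into the function that
  \<open>stepsize\<close> minimises.\<close>

lemma l1_norm_convex:
  assumes "\<gamma> \<in> {0..1}"
  shows "l1_norm (x + \<gamma> *\<^sub>R (y - x)) \<le> l1_norm x + (l1_norm y - l1_norm x) * \<gamma>"
proof -
  have "\<bar>x $ k + \<gamma> * (y $ k - x $ k)\<bar> \<le> \<bar>x $ k\<bar> + (\<bar>y $ k\<bar> - \<bar>x $ k\<bar>) * \<gamma>" for k
  proof -
    have "\<bar>x $ k + \<gamma> * (y $ k - x $ k)\<bar> = \<bar>(1 - \<gamma>) * x $ k + \<gamma> * y $ k\<bar>"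
      by (simp add: algebra_simps)
    also have "\<dots> \<le> \<bar>(1 - \<gamma>) * x $ k\<bar> + \<bar>\<gamma> * y $ k\<bar>" by (rule abs_triangle_ineq)
    also have "\<dots> = (1 - \<gamma>) * \<bar>x $ k\<bar> + \<gamma> * \<bar>y $ k\<bar>"
      using assms by (simp add: abs_mult)
    also have "\<dots> = \<bar>x $ k\<bar> + (\<bar>y $ k\<bar> - \<bar>x $ k\<bar>) * \<gamma>"
      by (simp add: algebra_simps)
    finally show ?thesis .
  qed
  then have "(\<Sum>k\<in>UNIV. \<bar>x $ k + \<gamma> * (y $ k - x $ k)\<bar>)
      \<le> (\<Sum>k\<in>UNIV. \<bar>x $ k\<bar> + (\<bar>y $ k\<bar> - \<bar>x $ k\<bar>) * \<gamma>)"
    by (rule sum_mono)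
  then show ?thesis
    by (simp add: l1_norm_def sum.distrib sum_distrib_right[symmetric] sum_subtractf)
qed

lemma loss_opa_step_le_0: "loss G b \<mu> (opa_step G b \<mu> c x) \<le> 0"
  by (simp add: opa_step_def Let_def loss_def)

lemma sum_power2_eq_norm: "(\<Sum>k\<in>UNIV. (p $ k)\<^sup>2) = (norm (p::real^'k::finite))\<^sup>2"
  unfolding norm_vec_def L2_set_def by (simp add: sum_nonneg)

text \<open>Each coordinate is compared with a gradient step of length \<open>1 / A k\<close>: it
  gains \<open>(p $ k)\<^sup>2 / (2 * A k)\<close> and pays at most
  \<open>\<mu> * \<bar>p $ k\<bar> / A k\<close> for the l1 term. The lower bound \<open>a\<close>
  on the weights controls the cost, the upper bound \<open>C\<close> the gain. A reset to 0 happens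
  only when the trial loss is positive, so it lowers the loss as well.\<close>

lemma loss_opa_step_decrease:
  fixes G :: "real^'k^'k::finite"
  assumes sym: "transpose G = G"
    and Lam: "\<And>d. d \<bullet> (G *v d) \<le> Lam * (norm d)\<^sup>2"
    and A: "\<And>k. a \<le> G $ k $ k + c $ k" "\<And>k. G $ k $ k + c $ k \<le> C"
    and a: "0 < a" and \<gamma>: "0 \<le> \<gamma>" "\<gamma> \<le> 1" "Lam * \<gamma> \<le> a" and \<mu>: "0 \<le> \<mu>"
  shows "loss G b \<mu> (opa_step G b \<mu> c x)
    \<le> loss G b \<mu> x + \<gamma> * (\<mu> * l1_norm (G *v x - b) / a - (norm (G *v x - b))\<^sup>2 / (2 * C))"
proof -
  define xh where "xh = best_response G b \<mu> c x"
  define s where "s = stepsize G b \<mu> x xh"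
  define p where "p = G *v x - b"
  define d where "d = xh - x"
  define A where "A k = G $ k $ k + c $ k" for k
  have Apos: "A k > 0" for k using A(1)[of k] a by (simp add: A_def)
  have s: "s \<in> {0..1}" using stepsize_le(2)[of \<gamma>] \<gamma> by (simp add: s_def)
  \<comment> \<open>The exact line search does no worse than the fixed stepsize \<open>\<gamma>\<close>, which is so small
    that the proximal weights absorb the coupling between the coordinates.\<close>
  have "loss G b \<mu> (opa_step G b \<mu> c x) \<le> loss G b \<mu> (x + s *\<^sub>R d)"
    by (auto simp: opa_step_def Let_def xh_def s_def d_def loss_def)
  also have "\<dots> \<le> loss G b \<mu> x + (1/2 * (d \<bullet> (G *v d)) * s\<^sup>2
     + (p \<bullet> d + \<mu> * (l1_norm xh - l1_norm x)) * s)"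
    unfolding loss_def quadratic_shift[OF sym]
    using mult_left_mono[OF l1_norm_convex[OF s, of x xh] \<mu>]
    by (simp add: p_def d_def algebra_simps)
  also have "\<dots> \<le> loss G b \<mu> x + (1/2 * (d \<bullet> (G *v d)) * \<gamma>\<^sup>2
     + (p \<bullet> d + \<mu> * (l1_norm xh - l1_norm x)) * \<gamma>)"
    using stepsize_le(1)[where \<gamma> = \<gamma> and xh = xh and x = x and G = G and b = b and \<mu> = \<mu>] \<gamma> by (simp add: p_def d_def s_def)
  \<comment> \<open>One of the two factors \<open>\<gamma>\<close> is spent on
    \<open>Lam * \<gamma> \<le> a\<close>. What remains is linear in \<open>\<gamma>\<close> and
    separates over the coordinates.\<close>
  also have "1/2 * (d \<bullet> (G *v d)) * \<gamma>\<^sup>2 \<le> \<gamma> * (\<Sum>k\<in>UNIV. A k / 2 * (d $ k)\<^sup>2)"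
  proof -
    have "1/2 * (d \<bullet> (G *v d)) * \<gamma>\<^sup>2 \<le> 1/2 * (Lam * (norm d)\<^sup>2) * \<gamma>\<^sup>2"
      using Lam[of d] by (intro mult_right_mono mult_left_mono) auto
    also have "\<dots> = \<gamma> * (1/2 * ((Lam * \<gamma>) * (norm d)\<^sup>2))" by (simp add: power2_eq_square)
    also have "\<dots> \<le> \<gamma> * (1/2 * (a * (norm d)\<^sup>2))"
      using \<gamma> by (intro mult_left_mono mult_right_mono) auto
    also have "1/2 * (a * (norm d)\<^sup>2) = (\<Sum>k\<in>UNIV. a / 2 * (d $ k)\<^sup>2)"
      unfolding sum_power2_eq_norm[symmetric] by (simp add: sum_distrib_left)
    also have "\<gamma> * (\<Sum>k\<in>UNIV. a / 2 * (d $ k)\<^sup>2) \<le> \<gamma> * (\<Sum>k\<in>UNIV. A k / 2 * (d $ k)\<^sup>2)"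
      using A(1) \<gamma> by (intro mult_left_mono sum_mono mult_right_mono) (auto simp: A_def)
    finally show ?thesis .
  qed
  also have "\<gamma> * (\<Sum>k\<in>UNIV. A k / 2 * (d $ k)\<^sup>2) + (p \<bullet> d + \<mu> * (l1_norm xh - l1_norm x)) * \<gamma>
    = \<gamma> * (\<Sum>k\<in>UNIV. (A k / 2 * (d $ k)\<^sup>2 + p $ k * d $ k + \<mu> * \<bar>xh $ k\<bar>) - \<mu> * \<bar>x $ k\<bar>)"
    by (simp add: inner_vec_def l1_norm_def sum.distrib sum_subtractf sum_distrib_left algebra_simps)
  also have "\<dots> \<le> \<gamma> * (\<Sum>k\<in>UNIV. \<mu> * \<bar>p $ k\<bar> / a - (p $ k)\<^sup>2 / (2 * C))"
  proof (intro mult_left_mono sum_mono \<gamma>(1))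
    fix k
    \<comment> \<open>The best response is at least as good as the scaled gradient step \<open>z\<close>.\<close>
    define z where "z = x $ k - p $ k / A k"
    have "(A k / 2 * (d $ k)\<^sup>2 + p $ k * d $ k + \<mu> * \<bar>xh $ k\<bar>)
      \<le> A k / 2 * (z - x $ k)\<^sup>2 + p $ k * (z - x $ k) + \<mu> * \<bar>z\<bar>"
      using best_response_le[OF sym, where k = k and c = c and x = x and b = b and \<mu> = \<mu> and z = z] Apos[of k] by (simp add: A_def d_def p_def xh_def)
    also have "A k / 2 * (z - x $ k)\<^sup>2 + p $ k * (z - x $ k) = - (p $ k)\<^sup>2 / (2 * A k)"
      using Apos[of k] by (simp add: z_def field_simps power2_eq_square)
    also have "\<mu> * \<bar>z\<bar> \<le> \<mu> * (\<bar>x $ k\<bar> + \<bar>p $ k\<bar> / A k)"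
      using abs_triangle_ineq4[of "x $ k" "p $ k / A k"] Apos[of k] \<mu>
      by (intro mult_left_mono) (simp_all add: z_def)
    finally have 1: "(A k / 2 * (d $ k)\<^sup>2 + p $ k * d $ k + \<mu> * \<bar>xh $ k\<bar>) - \<mu> * \<bar>x $ k\<bar>
      \<le> \<mu> * (\<bar>p $ k\<bar> / A k) - (p $ k)\<^sup>2 / (2 * A k)"
      by (simp add: algebra_simps)
    have "\<mu> * (\<bar>p $ k\<bar> / A k) \<le> \<mu> * (\<bar>p $ k\<bar> / a)"
      using A(1)[of k] a Apos[of k] \<mu> by (intro mult_left_mono divide_left_mono) (auto simp: A_def)
    moreover have "(p $ k)\<^sup>2 / (2 * C) \<le> (p $ k)\<^sup>2 / (2 * A k)"
      using A(1)[of k] A(2)[of k] a Apos[of k] by (intro divide_left_mono) (auto simp: A_def)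
    ultimately show "(A k / 2 * (d $ k)\<^sup>2 + p $ k * d $ k + \<mu> * \<bar>xh $ k\<bar>) - \<mu> * \<bar>x $ k\<bar>
      \<le> \<mu> * \<bar>p $ k\<bar> / a - (p $ k)\<^sup>2 / (2 * C)"
      using 1 by simp
  qed
  also have "(\<Sum>k\<in>UNIV. \<mu> * \<bar>p $ k\<bar> / a - (p $ k)\<^sup>2 / (2 * C)) = \<mu> * l1_norm p / a - (norm p)\<^sup>2 / (2 * C)"
    unfolding sum_power2_eq_norm[symmetric]
    by (simp add: l1_norm_def sum_subtractf sum_divide_distrib sum_distrib_left)
  finally show ?thesis by (simp add: p_def)
qed

section \<open>Convergence for converging data\<close>

text \<open>\<open>norm A\<close> is the Frobenius norm, the L2 norm of the row norms, so
  Cauchy-Schwarz in each row suffices.\<close>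

lemma norm_matrix_vector_mult_le:
  fixes A :: "real^'k::finite^'m::finite"
  shows "norm (A *v x) \<le> norm A * norm x"
proof -
  have "norm (A *v x) = L2_set (\<lambda>i. \<bar>A $ i \<bullet> x\<bar>) UNIV"
    by (simp add: norm_vec_def matrix_vector_mul_component)
  also have "\<dots> \<le> L2_set (\<lambda>i. norm (A $ i) * norm x) UNIV"
    by (intro L2_set_mono) (auto simp: Cauchy_Schwarz_ineq2)
  also have "\<dots> = norm A * norm x"
    by (simp add: norm_vec_def[of A] L2_set_left_distrib)
  finally show ?thesis .
qed

lemma abs_inner_matrix_vector_le:
  fixes A :: "real^'k::finite^'k"
  shows "\<bar>x \<bullet> (A *v x)\<bar> \<le> norm A * (norm x)\<^sup>2"
proof -
  have "\<bar>x \<bullet> (A *v x)\<bar> \<le> norm x * norm (A *v x)" by (rule Cauchy_Schwarz_ineq2)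
  also have "\<dots> \<le> norm x * (norm A * norm x)"
    by (intro mult_left_mono norm_matrix_vector_mult_le) auto
  finally show ?thesis by (simp add: power2_eq_square mult_ac)
qed

lemma l1_norm_le_norm: "l1_norm (x::real^'k::finite) \<le> real CARD('k) * norm x"
  unfolding l1_norm_def using sum_bounded_above[of UNIV "\<lambda>k. \<bar>x $ k\<bar>" "norm x"] component_le_norm_cart[of x]
  by simp

text \<open>The constant is the minimum of the quadratic form on the unit sphere, attained by
  compactness; homogeneity of degree 2 carries it to all vectors.\<close>

lemma positive_definite_lower_bound:
  fixes A :: "real^'k^'k::finite"
  assumes "\<And>x. x \<noteq> 0 \<Longrightarrow> x \<bullet> (A *v x) > 0"
  obtains l where "l > 0" "\<And>x. x \<bullet> (A *v x) \<ge> l * (norm x)\<^sup>2"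
proof -
  let ?S = "sphere 0 1 :: (real^'k) set"
  have cont: "continuous_on ?S (\<lambda>x. x \<bullet> (A *v x))"
    by (intro continuous_intros matrix_vector_mult_linear_continuous_on)
  have "axis undefined 1 \<in> ?S" by simp
  then have "?S \<noteq> {}" by blast
  from continuous_attains_inf[OF compact_sphere this cont]
  obtain u where u: "u \<in> ?S" "\<And>x. x \<in> ?S \<Longrightarrow> u \<bullet> (A *v u) \<le> x \<bullet> (A *v x)" by blast
  show ?thesis
  proof (rule that)
    have "u \<noteq> 0" using u(1) by auto
    then show "u \<bullet> (A *v u) > 0" by (rule assms)
    show "x \<bullet> (A *v x) \<ge> (u \<bullet> (A *v u)) * (norm x)\<^sup>2" for x
    proof (cases "x = 0")
      case False
      define s where "s = (1 / norm x) *\<^sub>R x"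
      have "u \<bullet> (A *v u) \<le> s \<bullet> (A *v s)" using False by (intro u(2)) (simp add: s_def)
      also have "\<dots> = (x \<bullet> (A *v x)) / (norm x)\<^sup>2"
        by (simp add: s_def matrix_vector_mult_scaleR power2_eq_square)
      finally show ?thesis using False by (simp add: field_simps)
    qed simp
  qed
qed

text \<open>Once \<open>e n\<close> is below \<open>(1 - q) * (r / 2)\<close>, the excess of
  \<open>a n\<close> over the level \<open>r / 2\<close> shrinks by the factor \<open>q\<close> in
  each step, so \<open>a\<close> eventually stays below \<open>r\<close>.\<close>

lemma perturbed_contraction_tendsto_0:
  fixes a e :: "nat \<Rightarrow> real"
  assumes nonneg: "\<And>n. a n \<ge> 0" and q: "0 \<le> q" "q < 1" and e: "e \<longlonglongrightarrow> 0"
    and step: "\<forall>\<^sub>F n in sequentially. a (Suc n) \<le> q * a n + e n"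
  shows "a \<longlonglongrightarrow> 0"
proof (rule LIMSEQ_I)
  fix r :: real assume r: "r > 0"
  have "(1 - q) * (r / 2) > 0" using r q by simp
  then have "\<forall>\<^sub>F n in sequentially. e n < (1 - q) * (r / 2)"
    using e by (rule order_tendstoD(2)[rotated])
  with step have "\<forall>\<^sub>F n in sequentially. a (Suc n) - r / 2 \<le> q * (a n - r / 2)"
    by eventually_elim (simp add: algebra_simps)
  then obtain N where N: "\<And>n. n \<ge> N \<Longrightarrow> a (Suc n) - r / 2 \<le> q * (a n - r / 2)"
    by (auto simp: eventually_sequentially)
  have dec: "a (N + n) - r / 2 \<le> q ^ n * a N" for n
  proof (induction n)
    case (Suc n)
    have "a (N + Suc n) - r / 2 \<le> q * (a (N + n) - r / 2)" using N[of "N + n"] by simp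
    also have "\<dots> \<le> q * (q ^ n * a N)" using Suc q by (intro mult_left_mono)
    finally show ?case by (simp add: mult_ac)
  qed (use r in simp)
  have "(\<lambda>n. q ^ n * a N) \<longlonglongrightarrow> 0 * a N"
    using q by (intro tendsto_mult LIMSEQ_power_zero tendsto_const) auto
  then have "\<forall>\<^sub>F n in sequentially. q ^ n * a N < r / 2"
    using r by (intro order_tendstoD(2)) auto
  then obtain m where m: "\<And>n. n \<ge> m \<Longrightarrow> q ^ n * a N < r / 2" by (auto simp: eventually_sequentially)
  have "norm (a n - 0) < r" if "n \<ge> N + m" for n
  proof -
    have "m \<le> n - N" using that by linarith
    then show ?thesis using dec[of "n - N"] m[of "n - N"] nonneg[of n] that by simp
  qed
  then show "\<exists>no. \<forall>n\<ge>no. norm (a n - 0) < r" by blast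
qed

text \<open>Both outcomes of the test have loss at most 0, and a quadratic part bounded below by
  \<open>l / 2\<close> times the squared norm allows this only near the origin. The bound does not
  involve the previous iterate, so it cannot accumulate over time.\<close>

lemma opa_step_bounded:
  fixes G :: "real^'k^'k::finite"
  assumes "l > 0" "\<And>x. x \<bullet> (G *v x) \<ge> l * (norm x)\<^sup>2" "\<mu> \<ge> 0"
  shows "norm (opa_step G b \<mu> c x) \<le> 2 * norm b / l"
proof -
  define y where "y = opa_step G b \<mu> c x"
  have "1/2 * (y \<bullet> (G *v y)) - b \<bullet> y + \<mu> * l1_norm y \<le> 0"
    using loss_opa_step_le_0[of G b \<mu> c x] by (simp add: loss_def y_def)
  moreover have "\<mu> * l1_norm y \<ge> 0" using assms(3) l1_norm_nonneg[of y] by (rule mult_nonneg_nonneg)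
  moreover have "b \<bullet> y \<le> norm b * norm y" by (rule norm_cauchy_schwarz)
  ultimately have "l * norm y * norm y \<le> 2 * norm b * norm y"
    using assms(2)[of y] by (simp add: power2_eq_square)
  then have "l * norm y \<le> 2 * norm b"
    by (cases "y = 0") (auto simp: mult_le_cancel_right)
  then show ?thesis using assms(1) by (simp add: y_def field_simps)
qed

text \<open>If \<open>G\<close>, \<open>b\<close> and \<open>\<mu>\<close> had the values
  \<open>Gs\<close>, \<open>Gs *v xs\<close> and 0, completing the square would make the left-hand
  side zero. The three error terms account for the three deviations.\<close>

lemma loss_quadratic_distance:
  fixes G Gs :: "real^'k^'k::finite"
  assumes sym: "transpose Gs = Gs" and x: "norm x \<le> R" and \<mu>: "\<mu> \<ge> 0"
  shows "\<bar>2 * loss G b \<mu> x - ((x - xs) \<bullet> (Gs *v (x - xs)) - xs \<bullet> (Gs *v xs))\<bar>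
    \<le> norm (G - Gs) * R\<^sup>2 + 2 * (norm (b - Gs *v xs) * R) + 2 * (\<mu> * (real CARD('k) * R))"
proof -
  have R: "0 \<le> R" using x norm_ge_zero order_trans by blast
  have eq: "2 * loss G b \<mu> x - ((x - xs) \<bullet> (Gs *v (x - xs)) - xs \<bullet> (Gs *v xs))
    = x \<bullet> ((G - Gs) *v x) - 2 * ((b - Gs *v xs) \<bullet> x) + 2 * (\<mu> * l1_norm x)"
    using symmetric_dot_matrix_vector[OF sym, of x xs]
    by (simp add: loss_def matrix_vector_mult_diff_distrib matrix_vector_mult_diff_rdistrib inner_diff_left inner_diff_right
        inner_commute[of "Gs *v xs" x] algebra_simps)
  have "norm (G - Gs) * (norm x)\<^sup>2 \<le> norm (G - Gs) * R\<^sup>2"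
    using x by (intro mult_left_mono power_mono) auto
  then have 1: "\<bar>x \<bullet> ((G - Gs) *v x)\<bar> \<le> norm (G - Gs) * R\<^sup>2"
    using abs_inner_matrix_vector_le[of x "G - Gs"] by linarith
  have "norm (b - Gs *v xs) * norm x \<le> norm (b - Gs *v xs) * R"
    using x by (intro mult_left_mono) auto
  then have 2: "\<bar>(b - Gs *v xs) \<bullet> x\<bar> \<le> norm (b - Gs *v xs) * R"
    using Cauchy_Schwarz_ineq2[of "b - Gs *v xs" x] by linarith
  have "l1_norm x \<le> real CARD('k) * norm x" by (rule l1_norm_le_norm)
  also have "\<dots> \<le> real CARD('k) * R" using x by (intro mult_left_mono) auto
  finally have 3: "\<mu> * l1_norm x \<le> \<mu> * (real CARD('k) * R)" using \<mu> by (intro mult_left_mono)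
  have 4: "\<mu> * l1_norm x \<ge> 0" using \<mu> l1_norm_nonneg[of x] by (rule mult_nonneg_nonneg)
  show ?thesis unfolding eq using 1 2 3 4 by linarith
qed

text \<open>The deterministic core, for a single realization. The bound \<open>C\<close> on the
  proximal weights keeps the guaranteed decrease per step proportional to the squared gradient with
  a fixed factor.\<close>

theorem opa_recursion_tendsto:
  fixes G :: "nat \<Rightarrow> real^'k^'k::finite" and Gs :: "real^'k^'k" and b c x :: "nat \<Rightarrow> real^'k"
  assumes sym: "\<And>t. transpose (G t) = G t" "transpose Gs = Gs"
    and pos: "\<And>x. x \<noteq> 0 \<Longrightarrow> x \<bullet> (Gs *v x) > 0"
    and G: "G \<longlonglongrightarrow> Gs" and b: "b \<longlonglongrightarrow> Gs *v xs"
    and \<mu>: "\<And>t. t \<ge> 1 \<Longrightarrow> \<mu> t \<ge> 0" "\<mu> \<longlonglongrightarrow> 0"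
    and c: "\<And>t k. t \<ge> 1 \<Longrightarrow> a \<le> G t $ k $ k + c t $ k" "\<And>t k. t \<ge> 1 \<Longrightarrow> c t $ k \<le> C"
    and a: "a > 0"
    and step: "\<And>t. t \<ge> 1 \<Longrightarrow> x (Suc t) = opa_step (G t) (b t) (\<mu> t) (c t) (x t)"
  shows "x \<longlonglongrightarrow> xs"
proof -
  obtain l where l: "l > 0" "\<And>x. x \<bullet> (Gs *v x) \<ge> l * (norm x)\<^sup>2"
    using positive_definite_lower_bound[OF pos] by metis
  \<comment> \<open>\<open>Lam\<close> and \<open>Bb\<close> bound \<open>norm (G t)\<close> and
    \<open>norm (b t)\<close> once these are within 1 of their limits. \<open>R\<close> is the bound
    of \<open>opa_step_bounded\<close> for \<open>norm b \<le> Bb\<close> and lower constant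
    \<open>l / 2\<close>.\<close>
  define Lam where "Lam = norm Gs + 1"
  define Bb where "Bb = norm (Gs *v xs) + 1"
  define R where "R = 4 * Bb / l"
  define D where "D = \<bar>C\<bar> + Lam + l"
  define \<gamma> where "\<gamma> = min 1 (a / Lam)"
  define K where "K = real CARD('k)"
  define w where "w t = x t - xs" for t
  define V where "V t = w t \<bullet> (Gs *v w t)" for t
  \<comment> \<open>\<open>\<eta>\<close> is the error from \<open>loss_quadratic_distance\<close>,
    \<open>\<rho>\<close> bounds the deviation of the gradient from its limiting form, and
    \<open>q\<close> and \<open>\<epsilon>\<close> are read off from the final computation.\<close>
  define \<eta> where "\<eta> t = norm (G t - Gs) * R\<^sup>2 + 2 * (norm (b t - Gs *v xs) * R) + 2 * (\<mu> t * (K * R))" for t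
  define \<rho> where "\<rho> t = norm (G t - Gs) * R + norm (b t - Gs *v xs)" for t
  define q where "q = 1 - \<gamma> * l / (2 * D)"
  define \<epsilon> where "\<epsilon> t = 2 * \<eta> t + 2 * \<gamma> * (\<mu> t * (K * (Lam * R + Bb)) / a) + \<gamma> * (\<rho> t)\<^sup>2 / D" for t
  have Lam: "Lam > 0" by (simp add: Lam_def add_nonneg_pos)
  have Bb: "Bb > 0" by (simp add: Bb_def add_nonneg_pos)
  have R: "R > 0" using Bb l by (simp add: R_def)
  have D: "D > 0" "l \<le> D" using Lam l by (auto simp: D_def)
  have \<gamma>: "0 < \<gamma>" "\<gamma> \<le> 1" "Lam * \<gamma> \<le> a"
  proof -
    show "0 < \<gamma>" "\<gamma> \<le> 1" using Lam a by (auto simp: \<gamma>_def)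
    have "\<gamma> \<le> a / Lam" by (simp add: \<gamma>_def)
    then show "Lam * \<gamma> \<le> a" using Lam by (simp add: field_simps)
  qed
  have G0: "(\<lambda>t. norm (G t - Gs)) \<longlonglongrightarrow> 0" using tendsto_norm_zero[OF LIM_zero[OF G]] .
  have b0: "(\<lambda>t. norm (b t - Gs *v xs)) \<longlonglongrightarrow> 0" using tendsto_norm_zero[OF LIM_zero[OF b]] .
  have "\<gamma> * l \<le> 1 * D" using \<gamma> l D by (intro mult_mono) auto
  then have q: "0 \<le> q" "q < 1" using \<gamma> l D by (auto simp: q_def field_simps)
  have \<eta>0: "\<eta> \<longlonglongrightarrow> 0"
  proof -
    have "\<eta> \<longlonglongrightarrow> 0 * R\<^sup>2 + 2 * (0 * R) + 2 * (0 * (K * R))"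
      unfolding \<eta>_def by (intro tendsto_intros G0 b0 \<mu>(2))
    then show ?thesis by simp
  qed
  have \<rho>0: "\<rho> \<longlonglongrightarrow> 0"
  proof -
    have "\<rho> \<longlonglongrightarrow> 0 * R + 0" unfolding \<rho>_def by (intro tendsto_intros G0 b0)
    then show ?thesis by simp
  qed
  have \<epsilon>0: "\<epsilon> \<longlonglongrightarrow> 0"
  proof -
    have "\<epsilon> \<longlonglongrightarrow> 2 * 0 + 2 * \<gamma> * (0 * (K * (Lam * R + Bb)) / a) + \<gamma> * 0\<^sup>2 / D"
      unfolding \<epsilon>_def using a D by (intro tendsto_intros \<eta>0 \<rho>0 \<mu>(2)) auto
    then show ?thesis by simp
  qed
  \<comment> \<open>Distance \<open>l / 2\<close> from \<open>Gs\<close> halves the lower bound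
    \<open>l\<close> at worst; distance 1 matches the summands 1 in \<open>Lam\<close> and
    \<open>Bb\<close>.\<close>
  have close: "\<forall>\<^sub>F t in sequentially. t \<ge> 1 \<and> norm (G t - Gs) \<le> min (l / 2) 1 \<and> norm (b t - Gs *v xs) \<le> 1"
  proof -
    have "\<forall>\<^sub>F t in sequentially. norm (G t - Gs) < min (l / 2) 1"
      using l by (intro order_tendstoD(2)[OF G0]) auto
    moreover have "\<forall>\<^sub>F t in sequentially. norm (b t - Gs *v xs) < 1"
      by (intro order_tendstoD(2)[OF b0]) auto
    ultimately show ?thesis using eventually_ge_at_top[of 1] by eventually_elim auto
  qed
  have bnd: "\<forall>\<^sub>F t in sequentially. norm (x (Suc t)) \<le> R \<and> norm (b t) \<le> Bb \<and> norm (G t) \<le> Lam"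
    using close
  proof eventually_elim
    case (elim t)
    have "z \<bullet> (G t *v z) \<ge> l / 2 * (norm z)\<^sup>2" for z
    proof -
      have "z \<bullet> (G t *v z) = z \<bullet> (Gs *v z) + z \<bullet> ((G t - Gs) *v z)"
        by (simp add: matrix_vector_mult_diff_rdistrib inner_diff_right)
      moreover have "norm (G t - Gs) * (norm z)\<^sup>2 \<le> l / 2 * (norm z)\<^sup>2"
        using elim by (intro mult_right_mono) auto
      ultimately show ?thesis
        using l(2)[of z] abs_inner_matrix_vector_le[of z "G t - Gs"] by linarith
    qed
    then have "norm (x (Suc t)) \<le> 2 * norm (b t) / (l / 2)"
      using step[of t] \<mu>(1)[of t] elim l opa_step_bounded[of "l / 2" "G t"] by simp
    also have bt: "norm (b t) \<le> Bb"
      using norm_triangle_sub[of "b t" "Gs *v xs"] elim by (simp add: Bb_def)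
    then have "2 * norm (b t) / (l / 2) \<le> R" using l by (simp add: R_def field_simps)
    finally have "norm (x (Suc t)) \<le> R" .
    moreover have "norm (G t) \<le> Lam"
      using norm_triangle_sub[of "G t" Gs] elim by (simp add: Lam_def)
    ultimately show ?case using bt by simp
  qed
  \<comment> \<open>The test bounds outputs \<open>x (Suc t)\<close>; shifting the index bounds the
    inputs \<open>x t\<close> as well.\<close>
  have bnd': "\<forall>\<^sub>F t in sequentially. norm (x t) \<le> R"
    by (subst eventually_sequentially_Suc[symmetric]) (use bnd in eventually_elim, simp)
  have "\<forall>\<^sub>F t in sequentially. V (Suc t) \<le> q * V t + \<epsilon> t"
    using close bnd bnd'
  proof eventually_elim
    case (elim t)
    define p where "p = G t *v x t - b t"
    define r where "r = (G t - Gs) *v x t - (b t - Gs *v xs)"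
    have \<mu>t: "\<mu> t \<ge> 0" using \<mu>(1) elim by simp
    \<comment> \<open>The gradient splits into the gradient of \<open>V / 2\<close> at
      \<open>x t\<close> and a data error \<open>r\<close>.\<close>
    have pr: "p = Gs *v w t + r"
      by (simp add: p_def r_def w_def matrix_vector_mult_diff_rdistrib matrix_vector_mult_diff_distrib)
    have r: "norm r \<le> \<rho> t"
    proof -
      have "norm r \<le> norm ((G t - Gs) *v x t) + norm (b t - Gs *v xs)"
        unfolding r_def by (rule norm_triangle_ineq4)
      also have "norm ((G t - Gs) *v x t) \<le> norm (G t - Gs) * norm (x t)" by (rule norm_matrix_vector_mult_le)
      also have "\<dots> \<le> norm (G t - Gs) * R" using elim by (intro mult_left_mono) auto
      finally show ?thesis by (simp add: \<rho>_def)
    qed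
    \<comment> \<open>Gradient domination: Cauchy-Schwarz bounds \<open>V t\<close> by
      \<open>norm (w t) * norm (Gs *v w t)\<close>, and the lower bound on the form gives
      \<open>l * norm (w t) \<le> norm (Gs *v w t)\<close>.\<close>
    have V_le: "l * V t \<le> (norm (Gs *v w t))\<^sup>2"
    proof (cases "w t = 0")
      case False
      have V: "V t \<le> norm (w t) * norm (Gs *v w t)" unfolding V_def by (rule norm_cauchy_schwarz)
      have "(l * norm (w t)) * norm (w t) \<le> norm (Gs *v w t) * norm (w t)"
        using V l(2)[of "w t"] by (simp add: V_def power2_eq_square mult_ac)
      then have 1: "l * norm (w t) \<le> norm (Gs *v w t)" using False by (simp add: mult_le_cancel_right)
      have "l * V t \<le> l * (norm (w t) * norm (Gs *v w t))" using V l by (intro mult_left_mono) auto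
      also have "\<dots> = (l * norm (w t)) * norm (Gs *v w t)" by simp
      also have "\<dots> \<le> norm (Gs *v w t) * norm (Gs *v w t)" using 1 by (intro mult_right_mono) auto
      finally show ?thesis by (simp add: power2_eq_square)
    qed (simp add: V_def)
    have p_ge: "l * V t / 2 - (\<rho> t)\<^sup>2 \<le> (norm p)\<^sup>2"
    proof -
      have "norm (Gs *v w t) \<le> norm p + norm r"
        using norm_triangle_ineq4[of p r] by (simp add: pr)
      then have "(norm (Gs *v w t))\<^sup>2 \<le> (norm p + norm r)\<^sup>2" by (intro power_mono) auto
      also have "\<dots> \<le> 2 * (norm p)\<^sup>2 + 2 * (norm r)\<^sup>2"
        using sum_squares_bound[of "norm p" "norm r"] by (simp add: power2_sum)
      finally show ?thesis using V_le power_mono[OF r norm_ge_zero, of 2] by simp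
    qed
    have p_le: "l1_norm p \<le> K * (Lam * R + Bb)"
    proof -
      have "norm p \<le> norm (G t *v x t) + norm (b t)" unfolding p_def by (rule norm_triangle_ineq4)
      also have "norm (G t *v x t) \<le> norm (G t) * norm (x t)" by (rule norm_matrix_vector_mult_le)
      also have "\<dots> \<le> Lam * R" using elim Lam by (intro mult_mono) auto
      finally have "norm p \<le> Lam * R + Bb" using elim by simp
      then have "K * norm p \<le> K * (Lam * R + Bb)" by (intro mult_left_mono) (auto simp: K_def)
      then show ?thesis using l1_norm_le_norm[of p] unfolding K_def by linarith
    qed
    have "loss (G t) (b t) (\<mu> t) (x (Suc t)) \<le> loss (G t) (b t) (\<mu> t) (x t)
       + \<gamma> * (\<mu> t * l1_norm p / a - (norm p)\<^sup>2 / (2 * D))"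
    proof -
      have Gkk: "G t $ k $ k \<le> Lam" for k
        using component_le_norm_cart[of "G t $ k" k] Finite_Cartesian_Product.norm_nth_le[of "G t" k] elim by linarith
      have "z \<bullet> (G t *v z) \<le> Lam * (norm z)\<^sup>2" for z
      proof -
        have "norm (G t) * (norm z)\<^sup>2 \<le> Lam * (norm z)\<^sup>2" using elim by (intro mult_right_mono) auto
        then show ?thesis using abs_inner_matrix_vector_le[of z "G t"] by linarith
      qed
      moreover have "G t $ k $ k + c t $ k \<le> D" for k
        using Gkk[of k] c(2)[of t k] elim l by (simp add: D_def)
      ultimately show ?thesis
        unfolding p_def using elim \<gamma> \<mu>t a
        by (subst step, simp) (rule loss_opa_step_decrease; use sym(1) c(1)[of t] in simp)
    qed
    \<comment> \<open>Both iterates are measured with the loss of the same time \<open>t\<close>, so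
      the constant \<open>xs \<bullet> (Gs *v xs)\<close> cancels and losses of different times are
      never compared.\<close>
    moreover have "\<bar>2 * loss (G t) (b t) (\<mu> t) z - ((z - xs) \<bullet> (Gs *v (z - xs)) - xs \<bullet> (Gs *v xs))\<bar> \<le> \<eta> t"
      if "norm z \<le> R" for z
      unfolding \<eta>_def K_def by (rule loss_quadratic_distance[OF sym(2) that \<mu>t])
    from this[of "x t"] this[of "x (Suc t)"]
    have "\<bar>2 * loss (G t) (b t) (\<mu> t) (x t) - (V t - xs \<bullet> (Gs *v xs))\<bar> \<le> \<eta> t"
      "\<bar>2 * loss (G t) (b t) (\<mu> t) (x (Suc t)) - (V (Suc t) - xs \<bullet> (Gs *v xs))\<bar> \<le> \<eta> t"
      using elim by (auto simp: V_def w_def)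
    ultimately have "V (Suc t) \<le> V t + 2 * \<eta> t + 2 * (\<gamma> * (\<mu> t * l1_norm p / a - (norm p)\<^sup>2 / (2 * D)))"
      by linarith
    also have "\<gamma> * (\<mu> t * l1_norm p / a - (norm p)\<^sup>2 / (2 * D))
      \<le> \<gamma> * (\<mu> t * (K * (Lam * R + Bb)) / a - (l * V t / 2 - (\<rho> t)\<^sup>2) / (2 * D))"
      using \<gamma> a D \<mu>t p_le p_ge by (intro mult_left_mono diff_mono divide_right_mono) auto
    \<comment> \<open>With free variables in place of the actual terms, isolating the factor of
      \<open>V t\<close> is plain field arithmetic.\<close>
    also have "v + 2 * e + 2 * (\<gamma> * (E - (l * v / 2 - r) / (2 * D)))
        = (1 - \<gamma> * l / (2 * D)) * v + (2 * e + 2 * \<gamma> * E + \<gamma> * r / D)" for v e E r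
      using D by (simp add: field_simps)
    finally show ?case by (simp only: q_def \<epsilon>_def)
  qed
  moreover have Vnn: "V t \<ge> l * (norm (w t))\<^sup>2" for t unfolding V_def by (rule l(2))
  moreover have "l * (norm (w t))\<^sup>2 \<ge> 0" for t using l by simp
  ultimately have "V \<longlonglongrightarrow> 0"
    using q \<epsilon>0 by (intro perturbed_contraction_tendsto_0[of V q \<epsilon>]) (auto intro: order_trans)
  then have "(\<lambda>t. sqrt (V t / l)) \<longlonglongrightarrow> sqrt (0 / l)"
    using l by (intro tendsto_intros) auto
  moreover have "norm (w t) \<le> sqrt (V t / l)" for t
    using Vnn[of t] l by (intro real_le_rsqrt) (simp add: field_simps)
  ultimately have "w \<longlonglongrightarrow> 0"
    by (intro Lim_null_comparison[of w "\<lambda>t. sqrt (V t / l)"]) auto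
  then show ?thesis unfolding w_def by (rule LIM_zero_cancel)
qed

section \<open>The strong law of large numbers under a fourth moment condition\<close>

context prob_space
begin

text \<open>Lower powers are dominated by \<open>1 + X \<omega> ^ n\<close>; evenness of
  \<open>n\<close> makes the dominating power nonnegative.\<close>

lemma integrable_power_le:
  fixes X :: "'a \<Rightarrow> real"
  assumes X: "random_variable borel X" "integrable M (\<lambda>\<omega>. X \<omega> ^ n)" and "even n" "k \<le> n"
  shows "integrable M (\<lambda>\<omega>. X \<omega> ^ k)"
proof (rule Bochner_Integration.integrable_bound)
  show "integrable M (\<lambda>\<omega>. 1 + X \<omega> ^ n)" using X by simp
  show "(\<lambda>\<omega>. X \<omega> ^ k) \<in> borel_measurable M" using X by measurable
  have "\<bar>x\<bar> ^ k \<le> 1 + x ^ n" for x :: real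
  proof (cases "\<bar>x\<bar> \<le> 1")
    case True
    then have "\<bar>x\<bar> ^ k \<le> 1" by (simp add: power_le_one)
    moreover have "x ^ n \<ge> 0" using \<open>even n\<close> by (simp add: zero_le_even_power)
    ultimately show ?thesis by linarith
  next
    case False
    then have "\<bar>x\<bar> ^ k \<le> \<bar>x\<bar> ^ n" using \<open>k \<le> n\<close> by (intro power_increasing) auto
    also have "\<dots> = x ^ n" using \<open>even n\<close> by (simp add: power_even_abs)
    finally show ?thesis by simp
  qed
  then show "AE \<omega> in M. norm (X \<omega> ^ k) \<le> norm (1 + X \<omega> ^ n)"
    using \<open>even n\<close> by (auto simp: power_abs zero_le_even_power)
qed

lemma indep_var_power_mult:
  fixes X Y :: "'a \<Rightarrow> real"
  assumes "indep_var borel X borel Y"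
    and "integrable M (\<lambda>\<omega>. X \<omega> ^ i)" "integrable M (\<lambda>\<omega>. Y \<omega> ^ j)"
  shows "integrable M (\<lambda>\<omega>. X \<omega> ^ i * Y \<omega> ^ j)"
    and "expectation (\<lambda>\<omega>. X \<omega> ^ i * Y \<omega> ^ j) = expectation (\<lambda>\<omega>. X \<omega> ^ i) * expectation (\<lambda>\<omega>. Y \<omega> ^ j)"
proof -
  have "indep_var borel ((\<lambda>x. x ^ i) \<circ> X) borel ((\<lambda>x. x ^ j) \<circ> Y)"
    by (rule indep_var_compose[OF assms(1)]) auto
  then have 1: "indep_var borel (\<lambda>\<omega>. X \<omega> ^ i) borel (\<lambda>\<omega>. Y \<omega> ^ j)" by (simp add: comp_def)
  show "integrable M (\<lambda>\<omega>. X \<omega> ^ i * Y \<omega> ^ j)"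
    using indep_var_integrable[OF 1] assms by simp
  show "expectation (\<lambda>\<omega>. X \<omega> ^ i * Y \<omega> ^ j) = expectation (\<lambda>\<omega>. X \<omega> ^ i) * expectation (\<lambda>\<omega>. Y \<omega> ^ j)"
    using indep_var_lebesgue_integral[OF 1] assms by simp
qed

text \<open>The new summand is independent of the partial sum and both are centred, so the odd mixed
  terms of the binomial expansion vanish in expectation. The surviving term, 6 times a product of
  second moments, makes the growth quadratic; hence mean and second moment are carried through the
  induction.\<close>

lemma fourth_moment_sum:
  fixes X :: "nat \<Rightarrow> 'a \<Rightarrow> real"
  assumes indep: "indep_vars (\<lambda>_. borel) X {1..}"
    and int: "\<And>n. n \<ge> 1 \<Longrightarrow> integrable M (\<lambda>\<omega>. X n \<omega> ^ 4)"
    and mean: "\<And>n. n \<ge> 1 \<Longrightarrow> expectation (X n) = 0"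
    and m2: "\<And>n. n \<ge> 1 \<Longrightarrow> expectation (\<lambda>\<omega>. X n \<omega> ^ 2) \<le> B"
    and m4: "\<And>n. n \<ge> 1 \<Longrightarrow> expectation (\<lambda>\<omega>. X n \<omega> ^ 4) \<le> B\<^sup>2"
    and B: "B \<ge> 0"
  defines "S \<equiv> \<lambda>n \<omega>. \<Sum>i=1..n. X i \<omega>"
  shows "integrable M (\<lambda>\<omega>. S n \<omega> ^ 4) \<and> expectation (S n) = 0
    \<and> expectation (\<lambda>\<omega>. S n \<omega> ^ 2) \<le> real n * B \<and> expectation (\<lambda>\<omega>. S n \<omega> ^ 4) \<le> 3 * (real n)\<^sup>2 * B\<^sup>2"
proof (induction n)
  case 0
  show ?case by (simp add: S_def)
next
  case (Suc n)
  let ?Y = "X (Suc n)"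
  have rv: "random_variable borel (X k)" if "k \<ge> 1" for k
    using indep that unfolding indep_vars_def by auto
  have rvS: "random_variable borel (S n)" unfolding S_def using rv by (intro borel_measurable_sum) auto
  have "indep_vars (\<lambda>_. borel) X (insert (Suc n) {1..n})"
    by (rule indep_vars_subset[OF indep]) auto
  then have "indep_var borel ?Y borel (\<lambda>\<omega>. \<Sum>i\<in>{1..n}. X i \<omega>)"
    by (intro indep_vars_sum) auto
  then have ind: "indep_var borel ?Y borel (S n)" by (simp add: S_def)
  have iY: "integrable M (\<lambda>\<omega>. ?Y \<omega> ^ k)" if "k \<le> 4" for k
    by (rule integrable_power_le[where n = 4]) (use that rv int in auto)
  have iS: "integrable M (\<lambda>\<omega>. S n \<omega> ^ k)" if "k \<le> 4" for k
    by (rule integrable_power_le[where n = 4]) (use that rvS Suc in auto)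
  note im = indep_var_power_mult(1)[OF ind iY iS] and em = indep_var_power_mult(2)[OF ind iY iS]
  have S: "S (Suc n) \<omega> = ?Y \<omega> + S n \<omega>" for \<omega> by (simp add: S_def)
  have e4: "S (Suc n) \<omega> ^ 4 = ?Y \<omega> ^ 4 + 4 * (?Y \<omega> ^ 3 * S n \<omega>) + 6 * (?Y \<omega> ^ 2 * S n \<omega> ^ 2)
     + 4 * (?Y \<omega> * S n \<omega> ^ 3) + S n \<omega> ^ 4" for \<omega>
    unfolding S by (simp add: algebra_simps eval_nat_numeral)
  have e2: "S (Suc n) \<omega> ^ 2 = ?Y \<omega> ^ 2 + 2 * (?Y \<omega> * S n \<omega>) + S n \<omega> ^ 2" for \<omega>
    unfolding S by (simp add: algebra_simps eval_nat_numeral)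
  note im' = im[of 1 1, simplified] im[of 3 1, simplified] im[of 2 2, simplified] im[of 1 3, simplified]
    iY[of 4, simplified] iY[of 2, simplified] iS[of 4, simplified] iS[of 2, simplified]
  note em' = em[of 1 1, simplified] em[of 3 1, simplified] em[of 2 2, simplified] em[of 1 3, simplified]
  have Y0: "expectation ?Y = 0" using mean[of "Suc n"] by simp
  have S0: "expectation (S n) = 0" using Suc by simp
  have Em4: "expectation (\<lambda>\<omega>. S (Suc n) \<omega> ^ 4) = expectation (\<lambda>\<omega>. ?Y \<omega> ^ 4)
     + 6 * (expectation (\<lambda>\<omega>. ?Y \<omega> ^ 2) * expectation (\<lambda>\<omega>. S n \<omega> ^ 2)) + expectation (\<lambda>\<omega>. S n \<omega> ^ 4)"
    unfolding e4 using im' by (simp add: em' Y0 S0)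
  have Em2: "expectation (\<lambda>\<omega>. S (Suc n) \<omega> ^ 2) = expectation (\<lambda>\<omega>. ?Y \<omega> ^ 2) + expectation (\<lambda>\<omega>. S n \<omega> ^ 2)"
    unfolding e2 using im' by (simp add: em' Y0 S0)
  have I: "integrable M (\<lambda>\<omega>. S (Suc n) \<omega> ^ 4)"
    unfolding e4 using im' by simp
  have E: "expectation (S (Suc n)) = 0"
    unfolding S using Suc mean[of "Suc n"] iY[of 1] iS[of 1] by simp
  have 2: "expectation (\<lambda>\<omega>. S (Suc n) \<omega> ^ 2) \<le> real (Suc n) * B"
    unfolding Em2 using m2[of "Suc n"] Suc by (simp add: algebra_simps)
  have "expectation (\<lambda>\<omega>. ?Y \<omega> ^ 2) * expectation (\<lambda>\<omega>. S n \<omega> ^ 2) \<le> B * (real n * B)"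
    using m2[of "Suc n"] Suc B by (intro mult_mono) auto
  then have "expectation (\<lambda>\<omega>. S (Suc n) \<omega> ^ 4) \<le> B\<^sup>2 + 6 * (B * (real n * B)) + 3 * (real n)\<^sup>2 * B\<^sup>2"
    unfolding Em4 using m4[of "Suc n"] Suc by simp
  \<comment> \<open>The constant 3 is dictated by
    \<open>1 + 6 * n + 3 * n\<^sup>2 \<le> 3 * (n + 1)\<^sup>2\<close>.\<close>
  also have "\<dots> \<le> 3 * (real (Suc n))\<^sup>2 * B\<^sup>2"
    by (simp add: power2_eq_square algebra_simps)
  finally show ?case using I E 2 by simp
qed

text \<open>By monotone convergence the expectation of the series is the finite sum of expectations,
  so the series is finite almost everywhere.\<close>

lemma AE_summable_of_expectation:
  fixes f :: "nat \<Rightarrow> 'a \<Rightarrow> real"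
  assumes "\<And>n. integrable M (f n)" "\<And>n \<omega>. f n \<omega> \<ge> 0" "summable (\<lambda>n. expectation (f n))"
  shows "AE \<omega> in M. summable (\<lambda>n. f n \<omega>)"
proof -
  have [measurable]: "f n \<in> borel_measurable M" for n using assms(1) by auto
  have "(\<integral>\<^sup>+\<omega>. (\<Sum>n. ennreal (f n \<omega>)) \<partial>M) = (\<Sum>n. \<integral>\<^sup>+\<omega>. ennreal (f n \<omega>) \<partial>M)"
    by (rule nn_integral_suminf) simp
  also have "\<dots> = (\<Sum>n. ennreal (expectation (f n)))"
    using assms by (intro suminf_cong nn_integral_eq_integral) auto
  also have "\<dots> = ennreal (\<Sum>n. expectation (f n))"
    using assms by (intro suminf_ennreal2 integral_nonneg_AE) auto
  finally have "(\<integral>\<^sup>+\<omega>. (\<Sum>n. ennreal (f n \<omega>)) \<partial>M) \<noteq> \<infinity>" by simp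
  then have "AE \<omega> in M. (\<Sum>n. ennreal (f n \<omega>)) \<noteq> \<infinity>"
    by (intro nn_integral_PInf_AE) auto
  then show ?thesis
    by eventually_elim (auto intro!: summable_suminf_not_top simp: assms)
qed

text \<open>The fourth moment of the average is of order \<open>1 / n\<^sup>2\<close>, hence
  summable; so the fourth powers of the averages are almost surely summable and tend to 0.\<close>

theorem strong_law_bounded_fourth_moment:
  fixes X :: "nat \<Rightarrow> 'a \<Rightarrow> real"
  assumes indep: "indep_vars (\<lambda>_. borel) X {1..}"
    and int: "\<And>n. n \<ge> 1 \<Longrightarrow> integrable M (\<lambda>\<omega>. X n \<omega> ^ 4)"
    and mean: "\<And>n. n \<ge> 1 \<Longrightarrow> expectation (X n) = 0"
    and m2: "\<And>n. n \<ge> 1 \<Longrightarrow> expectation (\<lambda>\<omega>. X n \<omega> ^ 2) \<le> B"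
    and m4: "\<And>n. n \<ge> 1 \<Longrightarrow> expectation (\<lambda>\<omega>. X n \<omega> ^ 4) \<le> B\<^sup>2"
    and B: "B \<ge> 0"
  shows "AE \<omega> in M. (\<lambda>n. (\<Sum>i=1..n. X i \<omega>) / real n) \<longlonglongrightarrow> 0"
proof -
  define f where "f n \<omega> = ((\<Sum>i=1..n. X i \<omega>) / real n) ^ 4" for n \<omega>
  note S = fourth_moment_sum[OF assms]
  \<comment> \<open>At \<open>n = 0\<close> both sides are 0, because division by zero yields
    0.\<close>
  have ef: "expectation (f n) \<le> 3 * B\<^sup>2 * (1 / (real n)\<^sup>2)" for n
  proof (cases "n = 0")
    case False
    have "expectation (f n) = expectation (\<lambda>\<omega>. (\<Sum>i=1..n. X i \<omega>) ^ 4) / real n ^ 4"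
      by (simp add: f_def[abs_def] power_divide)
    also have "\<dots> \<le> 3 * (real n)\<^sup>2 * B\<^sup>2 / real n ^ 4"
      using S[of n] by (intro divide_right_mono) auto
    also have "\<dots> = 3 * B\<^sup>2 * (1 / (real n)\<^sup>2)"
      using False by (simp add: field_simps eval_nat_numeral)
    finally show ?thesis .
  qed (simp add: f_def[abs_def])
  have fnn: "f n \<omega> \<ge> 0" for n \<omega> by (simp add: f_def zero_le_even_power)
  have "summable (\<lambda>n. expectation (f n))"
  proof (rule summable_comparison_test')
    show "summable (\<lambda>n. 3 * B\<^sup>2 * (1 / (real n)\<^sup>2))"
      using inverse_power_summable[of 2, where 'a=real] by (intro summable_mult) (simp add: inverse_eq_divide)
    show "norm (expectation (f n)) \<le> 3 * B\<^sup>2 * (1 / (real n)\<^sup>2)" if "n \<ge> 0" for n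
      using ef[of n] fnn by (simp add: integral_nonneg)
  qed
  moreover have "integrable M (f n)" for n
    using S[of n] by (simp add: f_def[abs_def] power_divide)
  ultimately have "AE \<omega> in M. summable (\<lambda>n. f n \<omega>)"
    using fnn by (intro AE_summable_of_expectation) auto
  then show ?thesis
  proof eventually_elim
    case (elim \<omega>)
    then have "(\<lambda>n. root 4 (f n \<omega>)) \<longlonglongrightarrow> root 4 0"
      by (intro tendsto_real_root summable_LIMSEQ_zero)
    moreover have "root 4 (y ^ 4) = \<bar>y\<bar>" for y :: real
      using real_root_power_cancel[of 4 "\<bar>y\<bar>"] by simp
    ultimately have "(\<lambda>n. \<bar>(\<Sum>i=1..n. X i \<omega>) / real n\<bar>) \<longlonglongrightarrow> 0"
      by (simp add: f_def)
    then show ?case by (rule tendsto_rabs_zero_cancel)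
  qed
qed

end

section \<open>Sample averages\<close>

context prob_space
begin

text \<open>After centring \<open>f\<close> at its mean under \<open>Z0\<close>, all moments of
  \<open>h (Z i)\<close> depend only on the common law, so bounds uniform in \<open>i\<close> come
  from \<open>Z0\<close> alone.\<close>

theorem strong_law_copies:
  fixes Z :: "nat \<Rightarrow> 'a \<Rightarrow> 'b::topological_space" and Z0 :: "'a \<Rightarrow> 'b" and f :: "'b \<Rightarrow> real"
  assumes indep: "indep_vars (\<lambda>_. borel) Z {1..}"
    and copies: "\<And>i. i \<ge> 1 \<Longrightarrow> distr M borel (Z i) = distr M borel Z0"
    and Z0: "random_variable borel Z0" and f: "f \<in> borel_measurable borel"
    and int: "integrable M (\<lambda>\<omega>. f (Z0 \<omega>) ^ 4)"
  shows "AE \<omega> in M. (\<lambda>n. (\<Sum>i=1..n. f (Z i \<omega>)) / real n) \<longlonglongrightarrow> expectation (\<lambda>\<omega>. f (Z0 \<omega>))"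
proof -
  define m where "m = expectation (\<lambda>\<omega>. f (Z0 \<omega>))"
  define h where "h z = f z - m" for z
  have h: "h \<in> borel_measurable borel" unfolding h_def using f by simp
  have Z: "random_variable borel (Z i)" if "i \<ge> 1" for i
    using indep that unfolding indep_vars_def by auto
  have fZ0: "random_variable borel (\<lambda>\<omega>. f (Z0 \<omega>))" using Z0 f by measurable
  have if0: "integrable M (\<lambda>\<omega>. f (Z0 \<omega>) ^ k)" if "k \<le> 4" for k
    by (rule integrable_power_le[OF fZ0 int]) (use that in auto)
  \<comment> \<open>The binomial expansion of \<open>(f (Z0 \<omega>) - m) ^ 4\<close> reduces
    integrability to powers of \<open>f\<close> up to 4.\<close>
  have "integrable M (\<lambda>\<omega>. f (Z0 \<omega>) ^ 4 - 4 * m * f (Z0 \<omega>) ^ 3 + 6 * m ^ 2 * f (Z0 \<omega>) ^ 2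
     - 4 * m ^ 3 * f (Z0 \<omega>) ^ 1 + m ^ 4)"
    using if0[of 1] if0[of 2] if0[of 3] if0[of 4] by simp
  also have "(\<lambda>\<omega>. f (Z0 \<omega>) ^ 4 - 4 * m * f (Z0 \<omega>) ^ 3 + 6 * m ^ 2 * f (Z0 \<omega>) ^ 2
     - 4 * m ^ 3 * f (Z0 \<omega>) ^ 1 + m ^ 4) = (\<lambda>\<omega>. h (Z0 \<omega>) ^ 4)"
    by (simp add: h_def fun_eq_iff algebra_simps eval_nat_numeral)
  finally have ih0: "integrable M (\<lambda>\<omega>. h (Z0 \<omega>) ^ 4)" .
  have transfer: "integrable M (\<lambda>\<omega>. h (Z i \<omega>) ^ k) \<longleftrightarrow> integrable M (\<lambda>\<omega>. h (Z0 \<omega>) ^ k)"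
    "expectation (\<lambda>\<omega>. h (Z i \<omega>) ^ k) = expectation (\<lambda>\<omega>. h (Z0 \<omega>) ^ k)" if "i \<ge> 1" for i k
    using copies[OF that] h Z[OF that] Z0
      integrable_distr_eq[of "Z i" M borel "\<lambda>z. h z ^ k"] integrable_distr_eq[of Z0 M borel "\<lambda>z. h z ^ k"]
      integral_distr[of "Z i" M borel "\<lambda>z. h z ^ k"] integral_distr[of Z0 M borel "\<lambda>z. h z ^ k"]
    by auto
  \<comment> \<open>A single number must bound the second moment by \<open>B\<close> and the fourth
    by \<open>B\<^sup>2\<close>.\<close>
  define B where "B = max (expectation (\<lambda>\<omega>. h (Z0 \<omega>) ^ 2)) (sqrt (expectation (\<lambda>\<omega>. h (Z0 \<omega>) ^ 4)))"
  have "expectation (\<lambda>\<omega>. h (Z0 \<omega>) ^ 4) \<ge> 0" by (simp add: zero_le_even_power)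
  then have B: "B \<ge> 0" "expectation (\<lambda>\<omega>. h (Z0 \<omega>) ^ 4) \<le> B\<^sup>2"
    by (auto simp: B_def le_max_iff_disj intro: sqrt_le_D)
  have "indep_vars (\<lambda>_. borel) (\<lambda>i \<omega>. h (Z i \<omega>)) {1..}"
    by (rule indep_vars_compose2[OF indep, where Y = "\<lambda>_. h"]) (rule h)
  then have "AE \<omega> in M. (\<lambda>n. (\<Sum>i=1..n. h (Z i \<omega>)) / real n) \<longlonglongrightarrow> 0"
  proof (rule strong_law_bounded_fourth_moment)
    fix i :: nat assume i: "i \<ge> 1"
    show "integrable M (\<lambda>\<omega>. h (Z i \<omega>) ^ 4)" using transfer(1)[OF i] ih0 by simp
    show "expectation (\<lambda>\<omega>. h (Z i \<omega>)) = 0"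
      using transfer(2)[OF i, of 1] if0[of 1] by (simp add: h_def m_def prob_space)
    show "expectation (\<lambda>\<omega>. h (Z i \<omega>) ^ 2) \<le> B" using transfer(2)[OF i, of 2] by (simp add: B_def)
    show "expectation (\<lambda>\<omega>. h (Z i \<omega>) ^ 4) \<le> B\<^sup>2" using transfer(2)[OF i, of 4] B by simp
  qed (rule B)
  then show ?thesis
  proof eventually_elim
    case (elim \<omega>)
    have "(\<lambda>n. (\<Sum>i=1..n. h (Z i \<omega>)) / real n + m) \<longlonglongrightarrow> 0 + m"
      by (intro tendsto_add elim tendsto_const)
    \<comment> \<open>Undoing the centring divides \<open>n * m\<close> by \<open>n\<close>, hence
      the restriction to positive \<open>n\<close>.\<close>
    moreover have "\<forall>\<^sub>F n in sequentially. (\<Sum>i=1..n. h (Z i \<omega>)) / real n + m = (\<Sum>i=1..n. f (Z i \<omega>)) / real n"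
      using eventually_gt_at_top[of 0]
      by eventually_elim (simp add: h_def sum_subtractf field_simps)
    ultimately show ?case by (simp add: m_def tendsto_cong)
  qed
qed

end

section \<open>Closure properties of finite moments\<close>

lemma finite_moments_bound:
  fixes X :: "'a \<Rightarrow> 'b::real_normed_vector" and Y :: "'a \<Rightarrow> 'c::{banach, second_countable_topology}"
  assumes "finite_moments M X" "Y \<in> borel_measurable M" "\<And>\<omega>. norm (Y \<omega>) \<le> norm (X \<omega>)"
  shows "finite_moments M Y"
  unfolding finite_moments_def
proof
  fix p
  show "integrable M (\<lambda>\<omega>. norm (Y \<omega>) ^ p)"
  proof (rule Bochner_Integration.integrable_bound)
    show "integrable M (\<lambda>\<omega>. norm (X \<omega>) ^ p)" using assms(1) by (simp add: finite_moments_def)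
    show "(\<lambda>\<omega>. norm (Y \<omega>) ^ p) \<in> borel_measurable M" using assms(2) by measurable
  qed (use assms(3) in \<open>auto intro!: power_mono\<close>)
qed

text \<open>The factors may be dependent, as are two entries of one regressor: the
  \<open>p\<close>-th moment of a product is controlled by the moments of order \<open>2 * p\<close>
  of its factors.\<close>

lemma finite_moments_mult:
  fixes X Y :: "'a \<Rightarrow> real"
  assumes X: "finite_moments M X" "X \<in> borel_measurable M" and Y: "finite_moments M Y" "Y \<in> borel_measurable M"
  shows "finite_moments M (\<lambda>\<omega>. X \<omega> * Y \<omega>)"
  unfolding finite_moments_def
proof
  fix p
  show "integrable M (\<lambda>\<omega>. norm (X \<omega> * Y \<omega>) ^ p)"
  proof (rule Bochner_Integration.integrable_bound)
    show "integrable M (\<lambda>\<omega>. norm (X \<omega>) ^ (2 * p) + norm (Y \<omega>) ^ (2 * p))"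
      using X(1) Y(1) unfolding finite_moments_def by (intro Bochner_Integration.integrable_add) auto
    show "(\<lambda>\<omega>. norm (X \<omega> * Y \<omega>) ^ p) \<in> borel_measurable M" using X Y by measurable
    have "\<bar>a * b\<bar> ^ p \<le> \<bar>a\<bar> ^ (2 * p) + \<bar>b\<bar> ^ (2 * p)" for a b :: real
    proof -
      have "2 * (\<bar>a\<bar> ^ p * \<bar>b\<bar> ^ p) \<le> (\<bar>a\<bar> ^ p)\<^sup>2 + (\<bar>b\<bar> ^ p)\<^sup>2"
        using sum_squares_bound[of "\<bar>a\<bar> ^ p" "\<bar>b\<bar> ^ p"] by simp
      moreover have "0 \<le> \<bar>a\<bar> ^ p * \<bar>b\<bar> ^ p" by simp
      ultimately have "\<bar>a\<bar> ^ p * \<bar>b\<bar> ^ p \<le> (\<bar>a\<bar> ^ p)\<^sup>2 + (\<bar>b\<bar> ^ p)\<^sup>2" by linarith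
      then show ?thesis by (simp add: abs_mult power_mult_distrib power_mult mult.commute[of 2])
    qed
    then show "AE \<omega> in M. norm (norm (X \<omega> * Y \<omega>) ^ p) \<le> norm (norm (X \<omega>) ^ (2 * p) + norm (Y \<omega>) ^ (2 * p))"
      by (auto simp: zero_le_even_power)
  qed
qed

lemma finite_moments_add:
  fixes X Y :: "'a \<Rightarrow> real"
  assumes X: "finite_moments M X" "X \<in> borel_measurable M" and Y: "finite_moments M Y" "Y \<in> borel_measurable M"
  shows "finite_moments M (\<lambda>\<omega>. X \<omega> + Y \<omega>)"
  unfolding finite_moments_def
proof
  fix p
  show "integrable M (\<lambda>\<omega>. norm (X \<omega> + Y \<omega>) ^ p)"
  proof (rule Bochner_Integration.integrable_bound)
    show "integrable M (\<lambda>\<omega>. 2 ^ p * (norm (X \<omega>) ^ p + norm (Y \<omega>) ^ p))"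
      using X(1) Y(1) unfolding finite_moments_def
      by (intro integrable_mult_right Bochner_Integration.integrable_add) auto
    show "(\<lambda>\<omega>. norm (X \<omega> + Y \<omega>) ^ p) \<in> borel_measurable M" using X Y by measurable
    have "\<bar>a + b\<bar> ^ p \<le> 2 ^ p * (\<bar>a\<bar> ^ p + \<bar>b\<bar> ^ p)" for a b :: real
    proof -
      have "\<bar>a + b\<bar> ^ p \<le> (2 * max \<bar>a\<bar> \<bar>b\<bar>) ^ p" by (intro power_mono) auto
      also have "\<dots> = 2 ^ p * max \<bar>a\<bar> \<bar>b\<bar> ^ p" by (simp add: power_mult_distrib)
      also have "\<dots> \<le> 2 ^ p * (\<bar>a\<bar> ^ p + \<bar>b\<bar> ^ p)"
        by (intro mult_left_mono) (auto simp: max_def)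
      finally show ?thesis .
    qed
    then show "AE \<omega> in M. norm (norm (X \<omega> + Y \<omega>) ^ p) \<le> norm (2 ^ p * (norm (X \<omega>) ^ p + norm (Y \<omega>) ^ p))"
      by (auto simp: abs_mult)
  qed
qed

lemma (in finite_measure) finite_moments_sum:
  fixes X :: "'i \<Rightarrow> 'a \<Rightarrow> real"
  assumes "finite I" "\<And>i. i \<in> I \<Longrightarrow> finite_moments M (X i)" "\<And>i. i \<in> I \<Longrightarrow> X i \<in> borel_measurable M"
  shows "finite_moments M (\<lambda>\<omega>. \<Sum>i\<in>I. X i \<omega>)"
  using assms
proof (induction I rule: finite_induct)
  case empty
  show ?case by (simp add: finite_moments_def)
next
  case (insert i I)
  then have "finite_moments M (\<lambda>\<omega>. X i \<omega> + (\<Sum>i\<in>I. X i \<omega>))"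
    by (intro finite_moments_add borel_measurable_sum) auto
  with insert show ?case by simp
qed

lemma finite_moments_integrable_power:
  fixes X :: "'a \<Rightarrow> real"
  assumes "finite_moments M X" "X \<in> borel_measurable M"
  shows "integrable M (\<lambda>\<omega>. X \<omega> ^ p)"
proof (rule Bochner_Integration.integrable_bound)
  show "integrable M (\<lambda>\<omega>. norm (X \<omega>) ^ p)" using assms(1) by (simp add: finite_moments_def)
  show "(\<lambda>\<omega>. X \<omega> ^ p) \<in> borel_measurable M" using assms(2) by measurable
qed (simp add: power_abs)

section \<open>Entries of sample averages, covariances, and measurability of vectors\<close>

lemma Gmat_nth: "Gmat g t $ i $ j = (\<Sum>\<tau>=1..t. \<Sum>n\<in>UNIV. g \<tau> n $ i * g \<tau> n $ j) / real t"
  by (simp add: Gmat_def outer_def)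

lemma bvec_nth: "bvec g y t $ k = (\<Sum>\<tau>=1..t. \<Sum>n\<in>UNIV. y \<tau> n * g \<tau> n $ k) / real t"
  by (simp add: bvec_def)

lemma transpose_Gmat: "transpose (Gmat g t) = Gmat g t"
  by (simp add: vec_eq_iff transpose_def Gmat_nth mult.commute)

lemma (in prob_space) covariance_eq:
  assumes "integrable M X" "integrable M Y" "integrable M (\<lambda>\<omega>. X \<omega> * Y \<omega>)"
  shows "covariance M X Y = expectation (\<lambda>\<omega>. X \<omega> * Y \<omega>) - expectation X * expectation Y"
proof -
  have "covariance M X Y = expectation (\<lambda>\<omega>. X \<omega> * Y \<omega> - expectation X * Y \<omega> - expectation Y * X \<omega>
    + expectation X * expectation Y)"
    unfolding covariance_def by (simp add: algebra_simps)
  also have "\<dots> = expectation (\<lambda>\<omega>. X \<omega> * Y \<omega>) - expectation X * expectation Y"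
    using assms by (simp add: prob_space)
  finally show ?thesis .
qed

lemma borel_measurable_vec_nth:
  fixes X :: "'a \<Rightarrow> ('b::topological_space)^'k::finite"
  assumes "X \<in> borel_measurable M"
  shows "(\<lambda>\<omega>. X \<omega> $ i) \<in> borel_measurable M"
  using assms by (rule borel_measurable_continuous_on[rotated]) (intro continuous_intros)

text \<open>Measurability is tested against the basis vectors \<open>axis n e\<close>, each of which
  sees one entry. This makes the block of all pairs of one time a random variable.\<close>

lemma borel_measurable_vec_lambda:
  fixes X :: "'n::finite \<Rightarrow> 'a \<Rightarrow> 'b::euclidean_space"
  assumes "\<And>n. X n \<in> borel_measurable M"
  shows "(\<lambda>\<omega>. \<chi> n. X n \<omega>) \<in> borel_measurable M"
proof (subst borel_measurable_euclidean_space, rule ballI)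
  fix u :: "'b^'n" assume "u \<in> Basis"
  then obtain n e where "u = axis n e" by (auto simp: Basis_vec_def)
  then show "(\<lambda>\<omega>. (\<chi> n. X n \<omega>) \<bullet> u) \<in> borel_measurable M"
    using assms[of n] by (simp add: inner_axis)
qed

text \<open>On the almost sure event where all entries of the sample averages converge, (A5) holds
  and the weights are bounded, \<open>opa_recursion_tendsto\<close> applies to each outcome. The
  hypothesis \<open>weights_bounded\<close>, with a bound that may depend on the outcome, supplies
  its constant \<open>C\<close>: large proximal weights shorten the steps.\<close>

theorem theorem4:
  fixes M :: "'a measure"
    and g :: "'n::finite \<Rightarrow> 'a \<Rightarrow> real^'k::finite"
    and v :: "'n \<Rightarrow> 'a \<Rightarrow> real"
    and gs :: "nat \<Rightarrow> 'n \<Rightarrow> 'a \<Rightarrow> real^'k"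
    and vs ys :: "nat \<Rightarrow> 'n \<Rightarrow> 'a \<Rightarrow> real"
    and xstar :: "real^'k"
    and \<mu> :: "nat \<Rightarrow> real"
    and c :: "nat \<Rightarrow> 'a \<Rightarrow> real^'k"
    and c0 :: real
  assumes prob: "prob_space M"
    and samples_indep:
      "prob_space.indep_vars M (\<lambda>_. borel) (\<lambda>\<tau> \<omega>. \<chi> n. (gs \<tau> n \<omega>, vs \<tau> n \<omega>)) {1..}"
    and samples_copies:
      "\<And>\<tau>. \<tau> \<ge> 1 \<Longrightarrow> distr M borel (\<lambda>\<omega>. \<chi> n. (gs \<tau> n \<omega>, vs \<tau> n \<omega>))
                    = distr M borel (\<lambda>\<omega>. \<chi> n. (g n \<omega>, v n \<omega>))"
    and model:
      "\<And>\<tau> n \<omega>. \<tau> \<ge> 1 \<Longrightarrow> \<omega> \<in> space M \<Longrightarrow> ys \<tau> n \<omega> = gs \<tau> n \<omega> \<bullet> xstar + vs \<tau> n \<omega>"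
    and weights_pos:
      "\<And>t k \<omega>. t \<ge> 1 \<Longrightarrow> \<omega> \<in> space M \<Longrightarrow> c t \<omega> $ k > 0"
    and weights_bounded:
      "AE \<omega> in M. \<exists>C. \<forall>t\<ge>1. \<forall>k. c t \<omega> $ k \<le> C"
    and A1_iid: "iid M g UNIV"
    and A1_bounded: "\<And>n i. integrable M (\<lambda>\<omega>. (g n \<omega> $ i)\<^sup>2)"
    and A1_pos_def: "\<And>n. positive_definite (covariance_matrix M (g n))"
    and A2_iid: "iid M v UNIV"
    and A2_mean: "\<And>n. (LINT \<omega>|M. v n \<omega>) = 0"
    and A2_variance: "\<And>n. integrable M (\<lambda>\<omega>. (v n \<omega>)\<^sup>2)"
    and A2_uncorrelated: "\<And>n k. covariance M (v n) (\<lambda>\<omega>. g n \<omega> $ k) = 0"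
    and A3_pos: "\<And>t. t \<ge> 1 \<Longrightarrow> \<mu> t > 0"
    and A3_lim: "\<mu> \<longlonglongrightarrow> 0"
    and A4_g: "\<And>n. finite_moments M (g n)"
    and A4_v: "\<And>n. finite_moments M (v n)"
    and A5_pos: "c0 > 0"
    and A5: "AE \<omega> in M. \<forall>t\<ge>1. \<forall>k. Gmat (\<lambda>\<tau> n. gs \<tau> n \<omega>) t $ k $ k + c t \<omega> $ k \<ge> c0"
    and A6: "\<And>t. t \<ge> 1 \<Longrightarrow> \<mu> t \<ge> \<mu> (Suc t)"
  shows "AE \<omega> in M.
    (\<lambda>t. opa (\<lambda>\<tau> n. gs \<tau> n \<omega>) (\<lambda>\<tau> n. ys \<tau> n \<omega>) \<mu> (\<lambda>t. c t \<omega>) t) \<longlonglongrightarrow> xstar"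
proof -
  interpret prob_space M by (rule prob)
  \<comment> \<open>All pairs of one time form a single random vector, since independence over time
    and equality in law are assumed for whole families.\<close>
  define Z where "Z \<tau> \<omega> = (\<chi> n. (gs \<tau> n \<omega>, vs \<tau> n \<omega>))" for \<tau> \<omega>
  define Z0 where "Z0 \<omega> = (\<chi> n. (g n \<omega>, v n \<omega>))" for \<omega>
  have gm: "random_variable borel (g n)" for n
    using A1_iid by (auto simp: iid_def indep_vars_def)
  have vm [measurable]: "random_variable borel (v n)" for n
    using A2_iid by (auto simp: iid_def indep_vars_def)
  have gim [measurable]: "random_variable borel (\<lambda>\<omega>. g n \<omega> $ i)" for n i
    using gm by (rule borel_measurable_vec_nth)
  have Z0m: "random_variable borel Z0"
    unfolding Z0_def using gm vm by (intro borel_measurable_vec_lambda borel_measurable_Pair)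
  have gfin: "finite_moments M (\<lambda>\<omega>. g n \<omega> $ i)" for n i
    using A4_g[of n] gim[of n i] by (rule finite_moments_bound) (simp add: component_le_norm_cart)
  have int1: "integrable M X" if "finite_moments M X" "X \<in> borel_measurable M" for X :: "'a \<Rightarrow> real"
    using finite_moments_integrable_power[OF that, of 1] by simp
  have ggfin: "finite_moments M (\<lambda>\<omega>. g n \<omega> $ i * g n \<omega> $ j)" for n i j
    by (intro finite_moments_mult gfin gim)
  have vgfin: "finite_moments M (\<lambda>\<omega>. v n \<omega> * g n \<omega> $ k)" for n k
    by (intro finite_moments_mult gfin gim A4_v vm)
  have ggint: "integrable M (\<lambda>\<omega>. g n \<omega> $ i * g n \<omega> $ j)" for n i j
    by (intro int1 ggfin) measurable
  have vgint: "integrable M (\<lambda>\<omega>. v n \<omega> * g n \<omega> $ k)" for n k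
    by (intro int1 vgfin) measurable
  have gint: "integrable M (\<lambda>\<omega>. g n \<omega> $ i)" for n i
    by (intro int1 gfin gim)
  have vint: "integrable M (v n)" for n
    by (intro int1 A4_v vm)
  \<comment> \<open>The model is inserted for the observation. In expectation, summed over
    \<open>n\<close>, the double sum becomes row \<open>k\<close> of \<open>Gs *v xstar\<close> and
    the noise term vanishes.\<close>
  have yg: "(g n \<omega> \<bullet> xstar + v n \<omega>) * g n \<omega> $ k
      = (\<Sum>j\<in>UNIV. xstar $ j * (g n \<omega> $ k * g n \<omega> $ j)) + v n \<omega> * g n \<omega> $ k" for n \<omega> k
    by (simp add: inner_vec_def sum_distrib_left algebra_simps)
  \<comment> \<open>This is the summed second moment matrix; it exceeds the sum of the covariance
    matrices by the outer products of the means.\<close>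
  define Gs where "Gs = (\<chi> i j. expectation (\<lambda>\<omega>. \<Sum>n\<in>UNIV. g n \<omega> $ i * g n \<omega> $ j))"
  have lawG: "AE \<omega> in M. (\<lambda>t. Gmat (\<lambda>\<tau> n. gs \<tau> n \<omega>) t $ i $ j) \<longlonglongrightarrow> Gs $ i $ j" for i j
  proof -
    define f where "f z = (\<Sum>n\<in>UNIV. fst (z $ n) $ i * fst (z $ n) $ j)" for z :: "((real^'k) \<times> real)^'n"
    have "AE \<omega> in M. (\<lambda>t. (\<Sum>\<tau>=1..t. f (Z \<tau> \<omega>)) / real t) \<longlonglongrightarrow> expectation (\<lambda>\<omega>. f (Z0 \<omega>))"
    proof (rule strong_law_copies[where Z = Z and ?Z0.0 = Z0 and f = f])
      show "indep_vars (\<lambda>_. borel) Z {1..}" using samples_indep by (simp add: Z_def[abs_def])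
      show "distr M borel (Z \<tau>) = distr M borel Z0" if "\<tau> \<ge> 1" for \<tau>
        using samples_copies[OF that] by (simp add: Z_def[abs_def] Z0_def[abs_def])
      show "f \<in> borel_measurable borel"
        unfolding f_def by (intro borel_measurable_continuous_onI continuous_intros)
      have "finite_moments M (\<lambda>\<omega>. f (Z0 \<omega>))"
        unfolding f_def Z0_def by (simp, intro finite_moments_sum ggfin) (simp_all, measurable)
      moreover have "random_variable borel (\<lambda>\<omega>. f (Z0 \<omega>))" unfolding f_def Z0_def by simp
      ultimately show "integrable M (\<lambda>\<omega>. f (Z0 \<omega>) ^ 4)" by (rule finite_moments_integrable_power)
    qed (rule Z0m)
    then show ?thesis by (simp add: f_def Z_def Z0_def Gmat_nth Gs_def)
  qed
  have lawb: "AE \<omega> in M. (\<lambda>t. bvec (\<lambda>\<tau> n. gs \<tau> n \<omega>) (\<lambda>\<tau> n. ys \<tau> n \<omega>) t $ k) \<longlonglongrightarrow> (Gs *v xstar) $ k" for k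
  proof -
    define f where "f z = (\<Sum>n\<in>UNIV. (fst (z $ n) \<bullet> xstar + snd (z $ n)) * fst (z $ n) $ k)"
      for z :: "((real^'k) \<times> real)^'n"
    have fZ0: "f (Z0 \<omega>) = (\<Sum>n\<in>UNIV. (\<Sum>j\<in>UNIV. xstar $ j * (g n \<omega> $ k * g n \<omega> $ j)) + v n \<omega> * g n \<omega> $ k)" for \<omega>
      by (simp add: f_def Z0_def yg)
    have fm: "f \<in> borel_measurable borel"
      unfolding f_def by (intro borel_measurable_continuous_onI continuous_intros)
    have "AE \<omega> in M. (\<lambda>t. (\<Sum>\<tau>=1..t. f (Z \<tau> \<omega>)) / real t) \<longlonglongrightarrow> expectation (\<lambda>\<omega>. f (Z0 \<omega>))"
    proof (rule strong_law_copies[where Z = Z and ?Z0.0 = Z0 and f = f])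
      show "indep_vars (\<lambda>_. borel) Z {1..}" using samples_indep by (simp add: Z_def[abs_def])
      show "distr M borel (Z \<tau>) = distr M borel Z0" if "\<tau> \<ge> 1" for \<tau>
        using samples_copies[OF that] by (simp add: Z_def[abs_def] Z0_def[abs_def])
      have const: "finite_moments M (\<lambda>\<omega>. r)" for r :: real by (simp add: finite_moments_def)
      have "finite_moments M (\<lambda>\<omega>. f (Z0 \<omega>))"
        unfolding fZ0
        by (intro finite_moments_sum finite_moments_add finite_moments_mult[OF const] ggfin vgfin)
          (simp_all, measurable)
      moreover have "random_variable borel (\<lambda>\<omega>. f (Z0 \<omega>))" unfolding fZ0 by simp
      ultimately show "integrable M (\<lambda>\<omega>. f (Z0 \<omega>) ^ 4)" by (rule finite_moments_integrable_power)
    qed (rule Z0m fm)+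
    moreover have "expectation (\<lambda>\<omega>. f (Z0 \<omega>)) = (Gs *v xstar) $ k"
    proof -
      \<comment> \<open>Zero covariance together with the zero mean of the noise gives a zero mixed
        moment, whatever the mean of the regressor.\<close>
      have "expectation (\<lambda>\<omega>. v n \<omega> * g n \<omega> $ k) = 0" for n
        using covariance_eq[OF vint gint vgint] A2_uncorrelated[of n k] A2_mean[of n] by simp
      then have "expectation (\<lambda>\<omega>. f (Z0 \<omega>))
          = (\<Sum>n\<in>UNIV. \<Sum>j\<in>UNIV. xstar $ j * expectation (\<lambda>\<omega>. g n \<omega> $ k * g n \<omega> $ j))"
        unfolding fZ0 using ggint vgint by simp
      also have "\<dots> = (\<Sum>j\<in>UNIV. \<Sum>n\<in>UNIV. xstar $ j * expectation (\<lambda>\<omega>. g n \<omega> $ k * g n \<omega> $ j))"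
        by (rule sum.swap)
      also have "\<dots> = (Gs *v xstar) $ k"
        using ggint by (simp add: Gs_def matrix_vector_mult_def sum_distrib_left sum_distrib_right mult_ac)
      finally show ?thesis .
    qed
    \<comment> \<open>The model equation is available on \<open>space M\<close>, which is enough
      under \<open>AE\<close>.\<close>
    moreover have "bvec (\<lambda>\<tau> n. gs \<tau> n \<omega>) (\<lambda>\<tau> n. ys \<tau> n \<omega>) t $ k = (\<Sum>\<tau>=1..t. f (Z \<tau> \<omega>)) / real t"
      if "\<omega> \<in> space M" for \<omega> t
      using that by (simp add: bvec_nth f_def Z_def model)
    ultimately show ?thesis by simp
  qed
  have Gs_sym: "transpose Gs = Gs" by (simp add: vec_eq_iff transpose_def Gs_def mult.commute)
  have Gs_pos: "x \<bullet> (Gs *v x) > 0" if "x \<noteq> 0" for x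
  proof -
    \<comment> \<open>Separating the means \<open>m n\<close> writes the form as covariance forms,
      positive by (A1), plus the squares \<open>(m n \<bullet> x)\<^sup>2\<close>.\<close>
    define m where "m n = (\<chi> i. expectation (\<lambda>\<omega>. g n \<omega> $ i))" for n
    have "Gs $ i $ j = (\<Sum>n\<in>UNIV. covariance_matrix M (g n) $ i $ j + m n $ i * m n $ j)" for i j
      using ggint by (simp add: Gs_def covariance_matrix_def m_def covariance_eq[OF gint gint ggint])
    then have "Gs *v x = (\<Sum>n\<in>UNIV. covariance_matrix M (g n) *v x + (m n \<bullet> x) *\<^sub>R m n)"
      by (simp add: vec_eq_iff matrix_vector_mult_def inner_vec_def sum_distrib_right sum_distrib_left
          sum.distrib distrib_left distrib_right sum.swap[of _ UNIV "UNIV :: 'n set"] mult_ac)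
    then have "x \<bullet> (Gs *v x) = (\<Sum>n\<in>UNIV. x \<bullet> (covariance_matrix M (g n) *v x) + (m n \<bullet> x)\<^sup>2)"
      by (simp add: inner_sum_right inner_add_right inner_commute[of x "m _"] power2_eq_square)
    also have "\<dots> > 0"
      using A1_pos_def that by (intro sum_pos add_pos_nonneg) (auto simp: positive_definite_def)
    finally show ?thesis .
  qed
  have "AE \<omega> in M. \<forall>i j. (\<lambda>t. Gmat (\<lambda>\<tau> n. gs \<tau> n \<omega>) t $ i $ j) \<longlonglongrightarrow> Gs $ i $ j"
    by (intro AE_all_countable[THEN iffD2] allI lawG)
  moreover have "AE \<omega> in M. \<forall>k. (\<lambda>t. bvec (\<lambda>\<tau> n. gs \<tau> n \<omega>) (\<lambda>\<tau> n. ys \<tau> n \<omega>) t $ k) \<longlonglongrightarrow> (Gs *v xstar) $ k"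
    by (intro AE_all_countable[THEN iffD2] allI lawb)
  ultimately show ?thesis
    using A5 weights_bounded
  proof eventually_elim
    case (elim \<omega>)
    then obtain C where C: "\<And>t k. t \<ge> 1 \<Longrightarrow> c t \<omega> $ k \<le> C" by blast
    show ?case
    \<comment> \<open>From time 1 on, the guard \<open>t = 0\<close> in \<open>opa\<close> is false
      and the sequence obeys the recursion; the dummy value at time 0 does not affect the
      limit.\<close>
    proof (rule opa_recursion_tendsto[where G = "Gmat (\<lambda>\<tau> n. gs \<tau> n \<omega>)" and \<mu> = \<mu> and a = c0 and C = C
          and c = "\<lambda>t. c t \<omega>"])
      show "Gmat (\<lambda>\<tau> n. gs \<tau> n \<omega>) \<longlonglongrightarrow> Gs" using elim(1) by (intro vec_tendstoI) auto
      show "bvec (\<lambda>\<tau> n. gs \<tau> n \<omega>) (\<lambda>\<tau> n. ys \<tau> n \<omega>) \<longlonglongrightarrow> Gs *v xstar"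
        using elim(2) by (intro vec_tendstoI) auto
    qed (use A3_lim A5_pos C elim(3) Gs_pos Gs_sym less_imp_le[OF A3_pos] transpose_Gmat in auto)
  qed
qed

end
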